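(* Let $n\ge 2$, let $\underline{n}=\{n_1,\dots,n_r\}$ with $n_1\le n_2\le\cdots\le n_r$ be a partition of $n$ (positive integers with $n_1+\cdots+n_r=n$), and let $N'$ be the least common multiple of $n_1,\dots,n_r$. Put $N=N'$ if $N'\left(\frac1{n_i}+\frac1{n_j}\right)\in 2\mathbb{Z}$ for all $i,j$, and $N=2N'$ if $N'\left(\frac1{n_i}+\frac1{n_j}\right)\notin 2\mathbb{Z}$ for some pair $(i,j)$. Define the sequence $\mathbf{s}=(s_0,s_1,\dots,s_{n-1})$ by $$\mathbf{s}=N\left(\tfrac{n_1+n_r}{2n_1n_r},\ \underbrace{\tfrac1{n_1},\dots,\tfrac1{n_1}}_{n_1-1},\ \tfrac{n_1+n_2}{2n_1n_2}-1,\ \underbrace{\tfrac1{n_2},\dots,\tfrac1{n_2}}_{n_2-1},\ \tfrac{n_2+n_3}{2n_2n_3}-1,\ \dots,\ \underbrace{\tfrac1{n_{r-1}},\dots,\tfrac1{n_{r-1}}}_{n_{r-1}-1},\ \tfrac{n_{r-1}+n_r}{2n_{r-1}n_r}-1,\ \underbrace{\tfrac1{n_r},\dots,\tfrac1{n_r}}_{n_r-1}\right).$$ Then for the affine Lie algebra $\widehat{\mathfrak{sl}}_n$ and every fundamental weight $\Lambda_k$, $k=0,1,\dots,n-1$, there is a constant $\mathrm{const}\in\mathbb{Q}$ such that $$\mathcal{F}_{\mathbf{s}}\left(\frac{\sum_{\gamma\in\overline{Q}+\overline{\Lambda}_k}e^{\Lambda_0+\gamma-\frac12|\gamma|^2\delta}}{\prod_{j\ge1}(1-e^{-j\delta})^{\operatorname{mult}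 j\delta}}\right)=q^{\mathrm{const}}\prod_{j\ge1}(1-q^{jN})\ \frac{\displaystyle\sum_{(k_1,\dots,k_r)\in\mathbb{Z}^r,\ k_1+\cdots+k_r=k}q^{\frac N2\left(\frac{k_1^2}{n_1}+\frac{k_2^2}{n_2}+\cdots+\frac{k_r^2}{n_r}\right)}}{\displaystyle\prod_{i=1}^{r}\prod_{j\ge1}\left(1-q^{\frac{jN}{n_i}}\right)}.$$
   Context: Let $l=n-1$. $\mathfrak{sl}_n$ has Cartan subalgebra $\mathfrak{h}$, simple roots $\alpha_i=\varepsilon_i-\varepsilon_{i+1}$ ($1\le i\le l$) and highest root $\theta=\alpha_1+\cdots+\alpha_l$; $(\cdot\mid\cdot)$ is the invariant form normalized so that $(\alpha_i\mid\alpha_i)=2$, and $|\gamma|^2=(\gamma\mid\gamma)$. The affine Lie algebra is $\widehat{\mathfrak{sl}}_n=\mathfrak{sl}_n\otimes\mathbb{C}[t,t^{-1}]\oplus(\mathbb{C}c+\mathbb{C}d)$, with $c$ central and $d$ the scaling element, of type $A_{l}^{(1)}$, with Cartan subalgebra $\hat{\mathfrak{h}}=\mathfrak{h}\oplus(\mathbb{C}c+\mathbb{C}d)$. The functional $\delta\in\hat{\mathfrak h}^*$ is zero on $\mathfrak{h}\oplus\mathbb{C}c$ with $\delta(d)=1$; $\alpha_0=\delta-\theta$, so $\delta=\alpha_0+\alpha_1+\cdots+\alpha_l$. The multiplicity of the imaginary root $j\delta$ is $\operatorname{mult} j\delta=\dim\mathfrak{h}=n-1$. The fundamental weights $\Lambda_0,\dots,\Lambda_{l}$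 are defined by $\Lambda_i(\alpha_j^\vee)=\delta_{ij}$ ($0\le j\le l$) and $\Lambda_i(d)=0$. A bar denotes orthogonal projection to $\mathfrak{h}^*$: $\overline{Q}=\sum_{i=1}^{l}\mathbb{Z}\alpha_i$ is the root lattice of $\mathfrak{sl}_n$, $\overline{\Lambda}_0=0$, and $\overline{\Lambda}_1,\dots,\overline{\Lambda}_{l}$ are the fundamental weights of $\mathfrak{sl}_n$ (rational combinations of $\alpha_1,\dots,\alpha_l$). $\mathcal{F}_{\mathbf{s}}$, the specialization of type $\mathbf{s}=(s_0,\dots,s_{l})$, is the homomorphism determined by $\mathcal{F}_{\mathbf s}(e^{-\alpha_i})=q^{s_i}$ for $i=0,\dots,l$; it is applied to rational combinations of the $\alpha_i$ (including $\delta$) in the exponents by $e^{-\sum c_i\alpha_i}\mapsto q^{\sum c_is_i}$. The common factor $e^{\Lambda_0}$ specializes to a fixed power of $q$, which is absorbed in $q^{\mathrm{const}}$; here $\mathrm{const}$ is an unspecified exponent that may depend on $\underline{n}$ and $k$. *)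

theory Defs
  imports
    "HOL-Analysis.Infinite_Products"
    "HOL-Computational_Algebra.Formal_Power_Series"
    "HOL-Library.Function_Algebras"
    "HOL-Library.Product_Plus"
begin

section \<open>The affine Lie algebra\<close>

text \<open>
  A triple (x, a, b) stands for the element (sum over m of x m times t^m) + a c + b d.
  Matrices are indexed by 1, ..., n and vanish outside this range.
\<close>

type_synonym aff = "(int \<Rightarrow> nat \<Rightarrow> nat \<Rightarrow> complex) \<times> complex \<times> complex"

definition sl_hat :: "nat \<Rightarrow> aff set" where
  "sl_hat n = {(x, a, b). finite {m. x m \<noteq> 0}
     \<and> (\<forall>m i j. x m i j \<noteq> 0 \<longrightarrow> i \<in> {1..n} \<and> j \<in> {1..n})
     \<and> (\<forall>m. (\<Sum>i=1..n. x m i i) = 0)}"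

definition mat_mult :: "nat \<Rightarrow> (nat \<Rightarrow> nat \<Rightarrow> complex) \<Rightarrow> (nat \<Rightarrow> nat \<Rightarrow> complex) \<Rightarrow> nat \<Rightarrow> nat \<Rightarrow> complex" where
  "mat_mult n A B = (\<lambda>i j. \<Sum>k=1..n. A i k * B k j)"

definition mat_trace :: "nat \<Rightarrow> (nat \<Rightarrow> nat \<Rightarrow> complex) \<Rightarrow> complex" where
  "mat_trace n A = (\<Sum>i=1..n. A i i)"

text \<open>
  [x t^p, y t^m] = [x, y] t^(p+m) + p tr(x y) c if p + m = 0 (without the last term otherwise),
  c is central, and [d, x t^m] = m x t^m.
\<close>

fun aff_bracket :: "nat \<Rightarrow> aff \<Rightarrow> aff \<Rightarrow> aff" where
  "aff_bracket n (x, a, b) (y, a', b') =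
     ((\<lambda>m i j. (\<Sum>p | x p \<noteq> 0. mat_mult n (x p) (y (m - p)) i j - mat_mult n (y (m - p)) (x p) i j)
               + b * of_int m * y m i j - b' * of_int m * x m i j),
      (\<Sum>p | x p \<noteq> 0. of_int p * mat_trace n (mat_mult n (x p) (y (- p)))),
      0)"

fun aff_scale :: "complex \<Rightarrow> aff \<Rightarrow> aff" where
  "aff_scale z (x, a, b) = ((\<lambda>m i j. z * x m i j), z * a, z * b)"

definition cartan_hat :: "nat \<Rightarrow> aff set" where
  "cartan_hat n = {(x, a, b) \<in> sl_hat n. \<forall>m i j. x m i j \<noteq> 0 \<longrightarrow> m = 0 \<and> i = j}"

definition diag_elt :: "(nat \<Rightarrow> complex) \<Rightarrow> aff" where
  "diag_elt h = ((\<lambda>m i j. if m = 0 \<and> i = j then h i else 0), 0, 0)"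

definition aff_c :: aff where "aff_c = (0, 1, 0)"

definition aff_d :: aff where "aff_d = (0, 0, 1)"

text \<open>The coroots; the one with index 0 is c minus the coroot of the highest root.\<close>

definition coroot :: "nat \<Rightarrow> nat \<Rightarrow> aff" where
  "coroot n j = (if j = 0 then aff_c - diag_elt (\<lambda>p. of_bool (p = 1) - of_bool (p = n))
                 else diag_elt (\<lambda>p. of_bool (p = j) - of_bool (p = j + 1)))"

section \<open>Weights\<close>

text \<open>
  A triple (x, a, b) stands for the functional (sum over i of x i times \<epsilon>_i) + a \<Lambda>_0 + b \<delta>.
  The \<epsilon>_i are linearly dependent on the trace zero diagonal matrices, so membership in
  \<open>weights n\<close> requires the coordinates x i to sum to zero; this makes the representation unique.
\<close>

type_synonym weight = "(nat \<Rightarrow> rat) \<times> rat \<times> rat"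

definition weights :: "nat \<Rightarrow> weight set" where
  "weights n = {(x, a, b). (\<forall>i. x i \<noteq> 0 \<longrightarrow> i \<in> {1..n}) \<and> (\<Sum>i=1..n. x i) = 0}"

fun weight_eval :: "nat \<Rightarrow> weight \<Rightarrow> aff \<Rightarrow> complex" where
  "weight_eval n (x, a, b) (h, p, r) = (\<Sum>i=1..n. of_rat (x i) * h 0 i i) + of_rat a * p + of_rat b * r"

fun wscale :: "rat \<Rightarrow> weight \<Rightarrow> weight"  (infixr \<open>\<bullet>w\<close> 75) where
  "z \<bullet>w (x, a, b) = ((\<lambda>i. z * x i), z * a, z * b)"

text \<open>The invariant form on weights; on the span of the \<open>\<alpha>_i\<close> with i > 0 it is the
  restriction of the standard dot product in \<epsilon>-coordinates.\<close>

fun wform :: "nat \<Rightarrow> weight \<Rightarrow> weight \<Rightarrow> rat" where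
  "wform n (x, a, b) (y, a', b') = (\<Sum>i=1..n. x i * y i) + a * b' + b * a'"

fun wbar :: "weight \<Rightarrow> weight" where
  "wbar (x, a, b) = (x, 0, 0)"

definition w\<Lambda>0 :: weight where "w\<Lambda>0 = (0, 1, 0)"

definition w\<delta> :: weight where "w\<delta> = (0, 0, 1)"

definition fin_simple_root :: "nat \<Rightarrow> weight" where
  "fin_simple_root i = ((\<lambda>p. of_bool (p = i) - of_bool (p = i + 1)), 0, 0)"

definition highest_root :: "nat \<Rightarrow> weight" where
  "highest_root n = (\<Sum>i=1..n-1. fin_simple_root i)"

definition simple_root :: "nat \<Rightarrow> nat \<Rightarrow> weight" where
  "simple_root n i = (if i = 0 then w\<delta> - highest_root n else fin_simple_root i)"

definition root_lattice :: "nat \<Rightarrow> weight set" where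
  "root_lattice n = {(\<Sum>i=1..n-1. of_int (c i) \<bullet>w fin_simple_root i) | c :: nat \<Rightarrow> int. True}"

definition fund_weight :: "nat \<Rightarrow> nat \<Rightarrow> weight" where
  "fund_weight n k = (THE \<Lambda>. \<Lambda> \<in> weights n
     \<and> (\<forall>j<n. weight_eval n \<Lambda> (coroot n j) = of_bool (j = k))
     \<and> weight_eval n \<Lambda> aff_d = 0)"

definition root_space :: "nat \<Rightarrow> weight \<Rightarrow> aff set" where
  "root_space n \<beta> = {X \<in> sl_hat n. \<forall>h\<in>cartan_hat n. aff_bracket n h X = aff_scale (weight_eval n \<beta> h) X}"

definition root_mult :: "nat \<Rightarrow> weight \<Rightarrow> nat" where
  "root_mult n \<beta> = vector_space.dim aff_scale (root_space n \<beta>)"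

section \<open>Formal series of exponentials\<close>

text \<open>
  f stands for the formal sum over all exponents x of f x times e^x. With weights as exponents
  these are the series in the exponentials of weights; with rational exponents they are the series in q. The
  operations below take the value 0 at a coefficient that would be an infinite sum.
\<close>

type_synonym 'e fser = "'e \<Rightarrow> complex"

definition fexp :: "'e \<Rightarrow> 'e fser" where
  "fexp u = (\<lambda>x. if x = u then 1 else 0)"

definition fexp_sum :: "'i set \<Rightarrow> ('i \<Rightarrow> 'e) \<Rightarrow> 'e fser" where
  "fexp_sum I u = (\<lambda>x. of_nat (card {i \<in> I. u i = x}))"

definition fmult :: "'e::ab_group_add fser \<Rightarrow> 'e fser \<Rightarrow> 'e fser"  (infixl \<open>\<star>\<close> 70) where
  "f \<star> g = (\<lambda>x. \<Sum>y | f y \<noteq> 0 \<and> g (x - y) \<noteq> 0. f y * g (x - y))"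

text \<open>The image of a power series under the substitution of e^u for the variable.\<close>

definition fps_at :: "'e::ab_group_add \<Rightarrow> complex fps \<Rightarrow> 'e fser" where
  "fps_at u P = (\<lambda>x. \<Sum>j | (\<Sum>i<j. u) = x \<and> fps_nth P j \<noteq> 0. fps_nth P j)"

section \<open>Specialization\<close>

text \<open>
  The weights of level 0 are spanned by the simple roots, so a weight has a unique expansion
  in \<open>\<Lambda>_0\<close> and the simple roots. The specialization maps the exponential of the negative of
  the i-th simple root to q^(s i) and the exponential of \<open>\<Lambda>_0\<close> to q^v.
\<close>

definition root_coeffs :: "nat \<Rightarrow> weight \<Rightarrow> nat \<Rightarrow> rat" where
  "root_coeffs n \<mu> = (THE c. (\<forall>i\<ge>n. c i = 0)
     \<and> \<mu> = fst (snd \<mu>) \<bullet>w w\<Lambda>0 + (\<Sum>i<n. c i \<bullet>w simple_root n i))"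

definition spec_exponent :: "nat \<Rightarrow> (nat \<Rightarrow> rat) \<Rightarrow> rat \<Rightarrow> weight \<Rightarrow> rat" where
  "spec_exponent n s v \<mu> = fst (snd \<mu>) * v - (\<Sum>i<n. root_coeffs n \<mu> i * s i)"

definition specialize :: "nat \<Rightarrow> (nat \<Rightarrow> rat) \<Rightarrow> rat \<Rightarrow> weight fser \<Rightarrow> rat fser" where
  "specialize n s v f = (\<lambda>x. \<Sum>\<mu> | f \<mu> \<noteq> 0 \<and> spec_exponent n s v \<mu> = x. f \<mu>)"

text \<open>Some of the s i may be negative, so the specialization is not defined on all series.\<close>

definition specializable :: "nat \<Rightarrow> (nat \<Rightarrow> rat) \<Rightarrow> rat \<Rightarrow> weight fser \<Rightarrow> bool" where
  "specializable n s v f \<longleftrightarrow> (\<forall>x. finite {\<mu>. f \<mu> \<noteq> 0 \<and> spec_exponent n s v \<mu> = x})"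

section \<open>The data attached to a partition\<close>

definition is_partition :: "nat list \<Rightarrow> nat \<Rightarrow> bool" where
  "is_partition ns n \<longleftrightarrow> sorted ns \<and> (\<forall>a\<in>set ns. 0 < a) \<and> sum_list ns = n"

definition part_N :: "nat list \<Rightarrow> nat" where
  "part_N ns = (let N' = Lcm (set ns) in
     if \<forall>a\<in>set ns. \<forall>b\<in>set ns. \<exists>z::int. of_nat N' * (1 / of_nat a + 1 / of_nat b) = (2 * of_int z :: rat)
     then N' else 2 * N')"

fun part_blocks :: "nat list \<Rightarrow> rat list" where
  "part_blocks [] = []"
| "part_blocks [a] = replicate (a - 1) (1 / of_nat a)"
| "part_blocks (a # b # cs) = replicate (a - 1) (1 / of_nat a)
     @ [of_nat (a + b) / of_nat (2 * a * b) - 1] @ part_blocks (b # cs)"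

definition part_s :: "nat list \<Rightarrow> nat \<Rightarrow> rat" where
  "part_s ns i = of_nat (part_N ns) *
     (([of_nat (hd ns + last ns) / of_nat (2 * hd ns * last ns)] @ part_blocks ns) ! i)"

section \<open>The two sides of the identity\<close>

text \<open>
  The sum over \<open>\<gamma>\<close> in the coset of the root lattice given by the k-th fundamental weight, divided
  by the product over j > 0 of (1 - e^(-j\<delta>))^(mult j\<delta>). The quotient is expanded in powers
  of e^(-\<delta>).
\<close>

definition lattice_quotient :: "nat \<Rightarrow> nat \<Rightarrow> weight fser" where
  "lattice_quotient n k =
     fexp_sum {\<beta> + wbar (fund_weight n k) | \<beta>. \<beta> \<in> root_lattice n}
       (\<lambda>\<gamma>. w\<Lambda>0 + \<gamma> - (wform n \<gamma> \<gamma> / 2) \<bullet>w w\<delta>)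
     \<star> fps_at (- w\<delta>) (inverse (\<Prod>j. (1 - fps_X ^ Suc j) ^ root_mult n (of_nat (Suc j) \<bullet>w w\<delta>)))"

definition theta_sum :: "nat list \<Rightarrow> nat \<Rightarrow> rat fser" where
  "theta_sum ns k =
     fexp_sum {ks :: int list. length ks = length ns \<and> sum_list ks = int k}
       (\<lambda>ks. of_nat (part_N ns) / 2 * (\<Sum>i<length ns. of_int (ks ! i) ^ 2 / of_nat (ns ! i)))"

text \<open>The division is exact, since every part divides \<open>part_N ns\<close>.\<close>

definition block_product :: "nat list \<Rightarrow> complex fps" where
  "block_product ns = (\<Prod>i<length ns. \<Prod>j. 1 - fps_X ^ (Suc j * (part_N ns div ns ! i)))"

end

theory Submission
  imports Defs "HOL-Computational_Algebra.Polynomial" "HOL-Computational_Algebra.Formal_Laurent_Series"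
begin

text \<open>
  In \<open>\<epsilon>\<close>-coordinates the elements of the coset of the root lattice are m - k/n with m an integer vector
  of coordinate sum k. The specialized exponent is a quadratic polynomial in m that splits over
  the blocks of the partition; in a block of size a, with d = N/a, it is up to a constant the sum over
  j < a of d (a m_j^2 + (2j + 1 - a) m_j)/2. By the Jacobi triple product in base q^N this is the
  exponent of z^m_0 ... z^m_(a-1) in the product of the a factors of index j mod a of the triple
  product in base q^d. Thus the sum over m and the sum over (k_1, ..., k_r) are
  both, up to Euler products, the coefficient of z^k in one product. To avoid convergence in z, the
  triple products are truncated to polynomials in z, compared coefficientwise, and the
  truncation is removed in the topology of formal power series in q^(1/2).
\<close>

section \<open>Infinite products and the finite triple product\<close>

text \<open>Bilateral series in z cannot be multiplied freely, so the triple product is kept in the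
  finite form given by the q-binomial theorem, times a power of z that makes it a polynomial. All
  truncations are multiples of one parameter M: a triple product attached to a part a has a M linear
  factors of each of its two kinds. Both factorizations then have their central power of z at n M,
  and the coefficient of z^(k + n M) can be compared for every M before M grows. The n factors on
  the lattice side all have base q^N, and each contributes one inverse Euler product in q^N, whereas
  the imaginary roots supply only n - 1 of these. The surplus one is the numerator of the right-hand
  side. Up to the constant, the exponents of q are half-integers, so the variable X of the power
  series is q^(1/2), and the bases q^N and q^d appear as X^(2 N) and X^(2 d). Entries of s can be
  negative, so it has to be proved that the specialization is defined. This comes from the growth of
  the quadratic exponent and not from the signs of s.\<close>

lemma tendsto_fps_mult:
  fixes f g :: "'b \<Rightarrow> 'a::ring_1 fps"
  assumes "(f \<longlongrightarrow> a) F" "(g \<longlongrightarrow> b) F"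
  shows "((\<lambda>x. f x * g x) \<longlongrightarrow> a * b) F"
proof (rule tendsto_fpsI)
  fix n
  have "\<forall>\<^sub>F x in F. \<forall>i\<in>{..n}. fps_nth (f x) i = fps_nth a i"
    by (rule eventually_ball_finite) (use assms(1) in \<open>auto simp: tendsto_fps_iff\<close>)
  moreover have "\<forall>\<^sub>F x in F. \<forall>i\<in>{..n}. fps_nth (g x) i = fps_nth b i"
    by (rule eventually_ball_finite) (use assms(2) in \<open>auto simp: tendsto_fps_iff\<close>)
  ultimately show "\<forall>\<^sub>F x in F. fps_nth (f x * g x) n = fps_nth (a * b) n"
    by eventually_elim (auto simp: fps_mult_nth intro!: sum.cong)
qed

lemma tendsto_fps_prod:
  fixes f :: "'i \<Rightarrow> 'b \<Rightarrow> 'a::comm_ring_1 fps"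
  assumes "\<And>i. i \<in> I \<Longrightarrow> (f i \<longlongrightarrow> a i) F"
  shows "((\<lambda>x. \<Prod>i\<in>I. f i x) \<longlongrightarrow> (\<Prod>i\<in>I. a i)) F"
  using assms
  by (induction I rule: infinite_finite_induct) (auto intro!: tendsto_fps_mult)

text \<open>The identity 1/a - 1/f = (1/a)(1/f)(f - a) carries agreement of f and a up to degree n
  over to the inverses.\<close>

lemma tendsto_fps_inverse:
  fixes f :: "'b \<Rightarrow> 'a::field fps"
  assumes lim: "(f \<longlongrightarrow> a) F" and a: "fps_nth a 0 \<noteq> 0"
  shows "((\<lambda>x. inverse (f x)) \<longlongrightarrow> inverse a) F"
proof (rule tendsto_fpsI)
  fix n
  have "\<forall>\<^sub>F x in F. \<forall>i\<in>{..n}. fps_nth (f x) i = fps_nth a i"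
    by (rule eventually_ball_finite) (use lim in \<open>auto simp: tendsto_fps_iff\<close>)
  thus "\<forall>\<^sub>F x in F. fps_nth (inverse (f x)) n = fps_nth (inverse a) n"
  proof eventually_elim
    case (elim x)
    have f0: "fps_nth (f x) 0 \<noteq> 0" using elim a by auto
    have "inverse a - inverse (f x) = (inverse a * inverse (f x)) * (f x - a)"
      using inverse_mult_eq_1[OF a] inverse_mult_eq_1[OF f0] by (algebra)
    moreover have "fps_nth ((inverse a * inverse (f x)) * (f x - a)) n = 0"
      unfolding fps_mult_nth[of _ "f x - a"] using elim by (intro sum.neutral) auto
    ultimately show ?case by (metis fps_sub_nth eq_iff_diff_eq_0)
  qed
qed

lemma fps_nth_mult_cong_1:
  fixes p f :: "'a::comm_ring_1 fps"
  assumes "fps_nth f 0 = 1" "\<And>i. 0 < i \<Longrightarrow> i \<le> j \<Longrightarrow> fps_nth f i = 0" "n \<le> j"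
  shows "fps_nth (p * f) n = fps_nth p n"
proof -
  have "fps_nth (p * f) n = (\<Sum>i=0..n. if i = n then fps_nth p i else 0)"
    unfolding fps_mult_nth using assms by (intro sum.cong) auto
  thus ?thesis by simp
qed

text \<open>The factor of index j is 1 + O(X^(j+1)), so coefficient i of the partial products is
  constant from the i-th product on. The limit is assembled from these stable coefficients.\<close>

lemma fps_prodinf_tendsto:
  fixes f :: "nat \<Rightarrow> 'a::idom fps"
  assumes f: "\<And>j. fps_nth (f j) 0 = 1" "\<And>i j. 0 < i \<Longrightarrow> i \<le> j \<Longrightarrow> fps_nth (f j) i = 0"
  shows "(\<lambda>n. \<Prod>j<n. f j) \<longlonglongrightarrow> (\<Prod>j. f j)" and "fps_nth (\<Prod>j. f j) 0 = 1"
proof -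
  define L where "L = Abs_fps (\<lambda>i. fps_nth (\<Prod>j<i. f j) i)"
  have stable: "fps_nth (\<Prod>j<n. f j) i = fps_nth L i" if "n \<ge> i" for n i
    using that
  proof (induction n rule: dec_induct)
    case (step n)
    thus ?case using fps_nth_mult_cong_1[of "f n" n i "\<Prod>j<n. f j"] f by simp
  qed (simp add: L_def)
  have lim: "(\<lambda>n. \<Prod>j<n. f j) \<longlonglongrightarrow> L"
    by (intro tendsto_fpsI eventually_mono[OF eventually_ge_at_top] stable)
  have L0: "fps_nth L 0 = 1" by (simp add: L_def)
  have "L \<noteq> 0" using L0 by auto
  have "(\<lambda>n. \<Prod>j\<le>n. f j) \<longlonglongrightarrow> L"
    using LIMSEQ_Suc[OF lim] by (simp add: lessThan_Suc_atMost)
  hence "f has_prod L" using \<open>L \<noteq> 0\<close> by (simp add: has_prod_def raw_has_prod_def)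
  \<comment> \<open>\<open>has_prod\<close> also assigns the value 0 to products with a vanishing
    factor. Constant coefficient 1 excludes that branch, so the description in
    \<open>prodinf\<close> has a unique solution.\<close>
  moreover have "p = L" if "f has_prod p" for p
  proof -
    have "f j \<noteq> 0" for j using f(1)[of j] by auto
    hence "(\<lambda>n. \<Prod>j\<le>n. f j) \<longlonglongrightarrow> p" using that
      by (auto simp: has_prod_def raw_has_prod_def)
    thus ?thesis using \<open>(\<lambda>n. \<Prod>j\<le>n. f j) \<longlonglongrightarrow> L\<close> LIMSEQ_unique by blast
  qed
  ultimately have "(\<Prod>j. f j) = L" unfolding prodinf_def by (intro the_equality)
  with lim L0 show "(\<lambda>n. \<Prod>j<n. f j) \<longlonglongrightarrow> (\<Prod>j. f j)" "fps_nth (\<Prod>j. f j) 0 = 1" by auto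
qed

text \<open>Euler's function at X^m, that is the infinite q-Pochhammer symbol (X^m; X^m), and not
  the totient. The finite symbol (c; c)_n is \<open>qpoch c n\<close>.\<close>

definition euler_phi :: "nat \<Rightarrow> 'a::field fps" where
  "euler_phi m = (\<Prod>j. 1 - fps_X ^ (Suc j * m))"

definition qpoch :: "'a::comm_ring_1 \<Rightarrow> nat \<Rightarrow> 'a" where
  "qpoch c n = (\<Prod>j<n. 1 - c ^ Suc j)"

lemma euler_phi_factor_nth:
  assumes "m > 0"
  shows "fps_nth (1 - fps_X ^ (Suc j * m) :: 'a::comm_ring_1 fps) 0 = 1"
    and "\<And>i. 0 < i \<Longrightarrow> i \<le> j \<Longrightarrow> fps_nth (1 - fps_X ^ (Suc j * m) :: 'a fps) i = 0"
proof -
  fix i assume "0 < i" "i \<le> j"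
  moreover have "Suc j * m \<ge> Suc j" using assms by (cases m) auto
  ultimately have "i \<noteq> Suc j * m" by linarith
  thus "fps_nth (1 - fps_X ^ (Suc j * m) :: 'a fps) i = 0"
    using \<open>0 < i\<close> by (simp add: fps_X_power_iff del: mult_Suc)
qed (use assms in \<open>auto simp: fps_X_power_iff\<close>)

lemma qpoch_tendsto_euler_phi:
  assumes "m > 0"
  shows "qpoch (fps_X ^ m :: 'a::field fps) \<longlonglongrightarrow> euler_phi m"
proof -
  have "qpoch (fps_X ^ m :: 'a fps) = (\<lambda>n. \<Prod>j<n. 1 - fps_X ^ (Suc j * m))"
  proof -
    have "(fps_X ^ m) ^ Suc j = (fps_X ^ (Suc j * m) :: 'a fps)" for j
      by (metis power_mult mult.commute)
    thus ?thesis by (simp only: qpoch_def[abs_def])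
  qed
  thus ?thesis
    using fps_prodinf_tendsto(1)[OF euler_phi_factor_nth[OF assms], where 'a = 'a]
    by (simp add: euler_phi_def)
qed

lemma euler_phi_nth_0: "m > 0 \<Longrightarrow> fps_nth (euler_phi m) 0 = 1"
  unfolding euler_phi_def by (rule fps_prodinf_tendsto(2)[OF euler_phi_factor_nth])

text \<open>The r-th powers of the partial products of Euler's function converge to its r-th power
  by continuity of multiplication. They are also the partial products on the left, which converge
  because the form 1 + O(X^(j+1)) survives taking powers.\<close>

lemma prodinf_power_eq_euler_phi:
  "(\<Prod>j. (1 - fps_X ^ Suc j) ^ r) = (euler_phi 1 ^ r :: 'a::field fps)"
proof (rule LIMSEQ_unique)
  have "(\<lambda>n. \<Prod>i<r. qpoch (fps_X ^ 1 :: 'a fps) n) \<longlonglongrightarrow> (\<Prod>i<r. euler_phi 1)"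
    by (intro tendsto_fps_prod qpoch_tendsto_euler_phi) auto
  thus "(\<lambda>n. \<Prod>j<n. (1 - fps_X ^ Suc j) ^ r) \<longlonglongrightarrow> (euler_phi 1 ^ r :: 'a fps)"
    by (simp add: qpoch_def prod_power_distrib)
  have A: "fps_nth (1 - fps_X ^ Suc j :: 'a fps) 0 = 1"
      "0 < i \<Longrightarrow> i \<le> j \<Longrightarrow> fps_nth (1 - fps_X ^ Suc j :: 'a fps) i = 0" for i j
    using euler_phi_factor_nth(1)[of 1 j] euler_phi_factor_nth(2)[of 1 i j] by simp_all
  have B: "fps_nth ((1 - fps_X ^ Suc j) ^ r :: 'a fps) 0 = 1 \<and>
      (0 < i \<longrightarrow> i \<le> j \<longrightarrow> fps_nth ((1 - fps_X ^ Suc j) ^ r :: 'a fps) i = 0)" for i j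
  proof (induction r)
    case (Suc r)
    have "fps_nth ((1 - fps_X ^ Suc j) ^ r * (1 - fps_X ^ Suc j) :: 'a fps) n =
      fps_nth ((1 - fps_X ^ Suc j) ^ r :: 'a fps) n" if "n \<le> j" for n
      by (rule fps_nth_mult_cong_1[OF A(1) A(2) that])
    from this[of 0] this[of i] show ?case using Suc by (simp add: mult.commute del: fps_mult_nth_0)
  qed auto
  show "(\<lambda>n. \<Prod>j<n. (1 - fps_X ^ Suc j) ^ r) \<longlonglongrightarrow> (\<Prod>j. (1 - fps_X ^ Suc j) ^ r :: 'a fps)"
    by (rule fps_prodinf_tendsto(1)) (use B in blast)+
qed

text \<open>Substitution is a ring homomorphism, which settles finite products. Coefficient t after
  the substitution involves only coefficients up to t before it, and these agree with those of a
  long enough finite product.\<close>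

lemma euler_phi_compose:
  assumes "m > 0" "l > 0"
  shows "euler_phi m oo fps_X ^ l = (euler_phi (m * l) :: 'a::field fps)"
proof (rule fps_ext)
  fix t
  have X0: "fps_nth (fps_X ^ l :: 'a fps) 0 = 0" using assms by simp
  have fps_X_power_compose': "fps_X ^ j oo fps_X ^ l = (fps_X ^ (j * l) :: 'a fps)" for j
    using fps_compose_power[OF X0, of fps_X j] X0 by (simp add: mult.commute flip: power_mult)
  have comp: "qpoch (fps_X ^ m) n oo fps_X ^ l = qpoch (fps_X ^ (m * l) :: 'a fps) n" for n
    unfolding qpoch_def fps_compose_prod_distrib[OF X0]
    by (intro prod.cong refl)
      (use X0 in \<open>simp add: fps_compose_sub_distrib mult_ac fps_X_power_compose' del: power_Suc flip: power_mult\<close>)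
  have "\<forall>\<^sub>F n in sequentially. \<forall>i\<in>{..t}.
      fps_nth (qpoch (fps_X ^ m) n) i = fps_nth (euler_phi m :: 'a fps) i"
    by (rule eventually_ball_finite)
      (use qpoch_tendsto_euler_phi[OF assms(1)] in \<open>auto simp: tendsto_fps_iff\<close>)
  moreover have "\<forall>\<^sub>F n in sequentially. fps_nth (qpoch (fps_X ^ (m * l)) n) t =
      fps_nth (euler_phi (m * l) :: 'a fps) t"
    using qpoch_tendsto_euler_phi[of "m * l"] assms by (auto simp: tendsto_fps_iff)
  ultimately have "\<forall>\<^sub>F n in sequentially.
    fps_nth (euler_phi m oo fps_X ^ l) t = fps_nth (euler_phi (m * l) :: 'a fps) t"
  proof eventually_elim
    case (elim n)
    thus ?case by (auto simp: fps_compose_nth simp flip: comp elim(2) intro!: sum.cong)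
  qed
  thus "fps_nth (euler_phi m oo fps_X ^ l) t = fps_nth (euler_phi (m * l) :: 'a fps) t"
    by simp
qed

text \<open>The value 0 at negative arguments makes the recursion \<open>rpoch_diff_1\<close> valid everywhere, so that
  the coefficient formula below has no boundary cases.\<close>

definition rpoch :: "'a::field fps \<Rightarrow> int \<Rightarrow> 'a fps" where
  "rpoch c j = (if j < 0 then 0 else inverse (qpoch c (nat j)))"

lemma rpoch_diff_1:
  assumes "fps_nth c 0 = 0"
  shows "rpoch c (j - 1) = (1 - c ^ nat j) * rpoch c j"
proof (cases "j \<ge> 1")
  case True
  define m where "m = nat (j - 1)"
  have j: "nat j = Suc m" "nat (j - 1) = m" using True by (auto simp: m_def)
  have "fps_nth (1 - c ^ Suc m) 0 \<noteq> 0" using assms by simp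
  hence "(1 - c ^ Suc m) * inverse (1 - c ^ Suc m) = 1"
    using inverse_mult_eq_1' by blast
  thus ?thesis using True
    by (simp add: rpoch_def j qpoch_def fps_inverse_mult mult.left_commute del: power_Suc)
next
  case False
  \<comment> \<open>For j \<le> 0 the factor \<open>1 - c ^ nat j\<close> is 1 - 1 = 0, in agreement
    with the value 0 of \<open>rpoch\<close> at j - 1.\<close>
  hence "j < 0 \<or> j = 0" by auto
  thus ?thesis by (auto simp: rpoch_def)
qed

text \<open>A natural number for negative k too, since k (k + 1) is never negative on the integers.
  Thus \<open>A ^ tri k * B ^ tri (k - 1)\<close> is the general term A^(k(k+1)/2) B^(k(k-1)/2) of
  Ramanujan's theta function f(A, B).\<close>

definition tri :: "int \<Rightarrow> nat" where "tri k = nat (k * (k + 1) div 2)"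

lemma int_tri: "2 * int (tri k) = k * (k + 1)"
proof -
  have "k * (k + 1) \<ge> 0" by (cases "k \<ge> 0") (auto simp: mult_nonpos_nonpos)
  moreover have "even (k * (k + 1))" by simp
  ultimately show ?thesis unfolding tri_def by (metis dvd_mult_div_cancel int_nat_eq pos_imp_zdiv_nonneg_iff zero_less_numeral)
qed

lemma tri_diff_1: "int (tri k) = int (tri (k - 1)) + k"
  using int_tri[of k] int_tri[of "k - 1"] by (simp add: algebra_simps)

text \<open>With c = A B this is the product of the 1 + A c^j z and the 1 + B c^j / z, times z^M:
  each factor of the second kind is multiplied by z to become z + B c^j. The power z^i therefore
  stands for z^(i - M).\<close>

definition jtp_poly :: "'a::comm_ring_1 \<Rightarrow> 'a \<Rightarrow> nat \<Rightarrow> nat \<Rightarrow> 'a poly" where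
  "jtp_poly A B L M = (\<Prod>j<L. [:1, A * (A * B) ^ j:]) * (\<Prod>j<M. [:B * (A * B) ^ j, 1:])"

text \<open>The three Pochhammer symbols form the Gaussian binomial coefficient of L + M over i in
  base A B. It is 0 for i outside 0, ..., L + M by the default value of
  \<open>rpoch\<close>.\<close>

definition jtp_coeff :: "'a::field fps \<Rightarrow> 'a fps \<Rightarrow> nat \<Rightarrow> nat \<Rightarrow> int \<Rightarrow> 'a fps" where
  "jtp_coeff A B L M i = A ^ tri (i - int M) * B ^ tri (i - int M - 1) *
     (qpoch (A * B) (L + M) * rpoch (A * B) (int (L + M) - i) * rpoch (A * B) i)"

text \<open>One of the two q-Pascal rules. Once the powers of A and B are matched and the common
  symbols taken out, it is the identity 1 - x y = (1 - x) + x (1 - y) with x = c^(L + M + 1 - i) and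
  y = c^i.\<close>

lemma jtp_coeff_Suc_left:
  assumes c0: "fps_nth (A * B) 0 = 0"
  shows "jtp_coeff A B (Suc L) M i = jtp_coeff A B L M i + A * (A * B) ^ L * jtp_coeff A B L M (i - 1)"
proof -
  define c where "c = A * B"
  define D where "D = L + M"
  define k where "k = i - int M"
  have idx: "i - int M = k" "i - 1 - int M = k - 1" "k - 1 - 1 = k - 2"
      "int (Suc D) - i = int D + 1 - i" "k + 1 - 1 = k" "int (L + M) - i = int D + 1 - i - 1" "int D - i = int D + 1 - i - 1" "int D - (i - 1) = int D + 1 - i" "int (Suc L + M) - i = int D + 1 - i"
      "int (L + M) - (i - 1) = int D + 1 - i" "Suc L + M = Suc D" "L + M = D"
    by (auto simp: k_def D_def)
  note r = rpoch_diff_1[OF c0, folded c_def]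
  \<comment> \<open>In the two outer ranges all three coefficients vanish through
    \<open>rpoch\<close>. The boundary values i = 0 and i = D + 1 need no separate
    treatment.\<close>
  consider "i < 0" | "i > int D + 1" | "0 \<le> i" "i \<le> int D + 1" by linarith
  thus ?thesis
  proof cases
    case 3
    define e where "e = nat (int D + 1 - i)"
    have W: "A * c ^ L * (A ^ tri (k - 1) * B ^ tri (k - 2)) = A ^ tri k * B ^ tri (k - 1) * c ^ e"
    proof -
      have "int (L + 1 + tri (k - 1)) = int (tri k + e)"
        using tri_diff_1[of k] 3 by (simp add: e_def k_def D_def)
      moreover have "int (L + tri (k - 2)) = int (tri (k - 1) + e)"
        using tri_diff_1[of "k - 1"] 3 by (simp add: e_def k_def D_def)
      ultimately have "L + 1 + tri (k - 1) = tri k + e" "L + tri (k - 2) = tri (k - 1) + e"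
        by linarith+
      thus ?thesis unfolding c_def power_mult_distrib
        by (smt (verit) mult.assoc mult.commute mult.left_commute power_add power_one_right add.commute)
    qed
    have cD: "c ^ Suc D = c ^ e * c ^ nat i"
    proof -
      have "Suc D = e + nat i" using 3 by (simp add: e_def)
      thus ?thesis by (metis power_add)
    qed
    have "A * c ^ L * jtp_coeff A B L M (i - 1) = (A * c ^ L * (A ^ tri (k - 1) * B ^ tri (k - 2)))
        * (qpoch c D * rpoch c (int D + 1 - i) * rpoch c (i - 1))"
      unfolding jtp_coeff_def idx c_def[symmetric] by (simp only: mult_ac)
    also have "\<dots> = A ^ tri k * B ^ tri (k - 1) * (qpoch c D * rpoch c (int D + 1 - i) * rpoch c i)
        * (c ^ e * (1 - c ^ nat i))"
      unfolding W r by (simp add: mult_ac)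
    finally have 1: "A * c ^ L * jtp_coeff A B L M (i - 1) = \<dots>" .
    have "jtp_coeff A B L M i = A ^ tri k * B ^ tri (k - 1) * (qpoch c D * rpoch c (int D + 1 - i - 1) * rpoch c i)"
      unfolding jtp_coeff_def idx c_def[symmetric] by (simp only: mult_ac)
    also have "\<dots> = A ^ tri k * B ^ tri (k - 1) * (qpoch c D * rpoch c (int D + 1 - i) * rpoch c i) * (1 - c ^ e)"
      unfolding r by (simp add: mult_ac e_def)
    finally have 2: "jtp_coeff A B L M i = \<dots>" .
    have "jtp_coeff A B (Suc L) M i = A ^ tri k * B ^ tri (k - 1) *
       (qpoch c (Suc D) * rpoch c (int D + 1 - i) * rpoch c i)"
      unfolding jtp_coeff_def idx c_def[symmetric] by (simp only: mult_ac)
    also have "qpoch c (Suc D) = qpoch c D * (1 - c ^ e * c ^ nat i)"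
      unfolding cD[symmetric] by (simp add: qpoch_def)
    moreover have "W * (q * (1 - x * y) * r * s) = W * (q * r * s) * (1 - x) + W * (q * r * s) * (x * (1 - y))" for W q r s x y :: "'a fps"
      by (simp add: algebra_simps)
    ultimately show ?thesis unfolding 1[unfolded c_def] 2 c_def by simp
  qed (auto simp: jtp_coeff_def rpoch_def D_def)
qed

text \<open>The other q-Pascal rule, with the splitting 1 - x y = y (1 - x) + (1 - y). The new
  factor z + B c^M also moves the centre from M to M + 1, which is why k is measured from the new
  centre.\<close>

lemma jtp_coeff_Suc_right:
  assumes c0: "fps_nth (A * B) 0 = 0"
  shows "jtp_coeff A B L (Suc M) i = B * (A * B) ^ M * jtp_coeff A B L M i + jtp_coeff A B L M (i - 1)"
proof -
  define c where "c = A * B"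
  define D where "D = L + M"
  define k where "k = i - 1 - int M"
  have idx: "i - int (Suc M) = k" "i - int M = k + 1" "i - int M - 1 = k" "i - 1 - int M = k"
      "int (Suc D) - i = int D + 1 - i" "k + 1 - 1 = k" "int (L + M) - i = int D + 1 - i - 1" "int D - i = int D + 1 - i - 1" "int D - (i - 1) = int D + 1 - i" "int (L + Suc M) - i = int D + 1 - i"
      "int (L + M) - (i - 1) = int D + 1 - i" "L + Suc M = Suc D" "L + M = D"
    by (auto simp: k_def D_def)
  note r = rpoch_diff_1[OF c0, folded c_def]
  consider "i < 0" | "i > int D + 1" | "0 \<le> i" "i \<le> int D + 1" by linarith
  thus ?thesis
  proof cases
    case 3
    define e where "e = nat (int D + 1 - i)"
    have W: "B * c ^ M * (A ^ tri (k + 1) * B ^ tri k) = A ^ tri k * B ^ tri (k - 1) * c ^ nat i"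
    proof -
      have "int (M + tri (k + 1)) = int (tri k + nat i)"
        using tri_diff_1[of "k + 1"] 3 by (simp add: k_def del: diff_diff_eq) (simp add: algebra_simps)
      moreover have "int (M + 1 + tri k) = int (tri (k - 1) + nat i)"
        using tri_diff_1[of k] 3 by (simp add: k_def)
      ultimately have "M + tri (k + 1) = tri k + nat i" "M + 1 + tri k = tri (k - 1) + nat i"
        by linarith+
      thus ?thesis unfolding c_def power_mult_distrib
        by (smt (verit) mult.assoc mult.commute mult.left_commute power_add power_one_right add.commute)
    qed
    have cD: "c ^ Suc D = c ^ e * c ^ nat i"
    proof -
      have "Suc D = e + nat i" using 3 by (simp add: e_def)
      thus ?thesis by (metis power_add)
    qed
    have "B * c ^ M * jtp_coeff A B L M i = (B * c ^ M * (A ^ tri (k + 1) * B ^ tri k))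
        * (qpoch c D * rpoch c (int D + 1 - i - 1) * rpoch c i)"
      unfolding jtp_coeff_def idx c_def[symmetric] by (simp only: mult_ac)
    also have "\<dots> = A ^ tri k * B ^ tri (k - 1) * (qpoch c D * rpoch c (int D + 1 - i) * rpoch c i)
        * (c ^ nat i * (1 - c ^ e))"
      unfolding W r by (simp add: mult_ac e_def)
    finally have 1: "B * c ^ M * jtp_coeff A B L M i = \<dots>" .
    have "jtp_coeff A B L M (i - 1) = A ^ tri k * B ^ tri (k - 1) * (qpoch c D * rpoch c (int D + 1 - i) * rpoch c (i - 1))"
      unfolding jtp_coeff_def idx c_def[symmetric] by (simp only: mult_ac)
    also have "\<dots> = A ^ tri k * B ^ tri (k - 1) * (qpoch c D * rpoch c (int D + 1 - i) * rpoch c i) * (1 - c ^ nat i)"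
      unfolding r by (simp add: mult_ac)
    finally have 2: "jtp_coeff A B L M (i - 1) = \<dots>" .
    have "jtp_coeff A B L (Suc M) i = A ^ tri k * B ^ tri (k - 1) *
       (qpoch c (Suc D) * rpoch c (int D + 1 - i) * rpoch c i)"
      unfolding jtp_coeff_def idx c_def[symmetric] by (simp only: mult_ac)
    also have "qpoch c (Suc D) = qpoch c D * (1 - c ^ e * c ^ nat i)"
      unfolding cD[symmetric] by (simp add: qpoch_def)
    moreover have "W * (q * (1 - x * y) * r * s) = W * (q * r * s) * (y * (1 - x)) + W * (q * r * s) * (1 - y)" for W q r s x y :: "'a fps"
      by (simp add: algebra_simps)
    ultimately show ?thesis unfolding 1[unfolded c_def] 2 c_def by simp
  qed (auto simp: jtp_coeff_def rpoch_def D_def)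
qed

lemma jtp_coeff_neg: "i < 0 \<Longrightarrow> jtp_coeff A B L M i = 0"
  by (simp add: jtp_coeff_def rpoch_def)

text \<open>The finite form of the Jacobi triple product.\<close>

lemma coeff_jtp_poly:
  fixes A B :: "'a::field fps"
  assumes c0: "fps_nth (A * B) 0 = 0"
  shows "coeff (jtp_poly A B L M) i = jtp_coeff A B L M (int i)"
proof (induction L arbitrary: i)
  case 0
  show ?case
  proof (induction M arbitrary: i)
    case 0
    show ?case by (cases i) (auto simp: jtp_poly_def jtp_coeff_def qpoch_def rpoch_def tri_def)
  next
    case (Suc M)
    have "jtp_poly A B 0 (Suc M) = [:B * (A * B) ^ M, 1:] * jtp_poly A B 0 M"
      by (simp only: jtp_poly_def prod.lessThan_Suc mult_ac)
    also have "coeff \<dots> i = B * (A * B) ^ M * coeff (jtp_poly A B 0 M) i +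
        (if i = 0 then 0 else coeff (jtp_poly A B 0 M) (i - 1))"
      by (cases i) (simp_all add: mult_pCons_left)
    finally show ?case unfolding jtp_coeff_Suc_right[OF c0] Suc
      by (auto simp: jtp_coeff_neg of_nat_diff)
  qed
next
  case (Suc L)
  have "jtp_poly A B (Suc L) M = [:1, A * (A * B) ^ L:] * jtp_poly A B L M"
    by (simp only: jtp_poly_def prod.lessThan_Suc mult_ac)
  also have "coeff \<dots> i = coeff (jtp_poly A B L M) i +
      (if i = 0 then 0 else A * (A * B) ^ L * coeff (jtp_poly A B L M) (i - 1))"
    by (cases i) (simp_all add: mult_pCons_left)
  finally show ?case unfolding jtp_coeff_Suc_left[OF c0] Suc
    by (auto simp: jtp_coeff_neg of_nat_diff)
qed

section \<open>Coefficients of a product of several polynomials\<close>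

lemma finite_nat_lists_sum: "finite {ks :: nat list. length ks = l \<and> sum_list ks = K}"
  by (rule finite_subset[OF _ finite_lists_length_eq[of "{..K}" l]]) (auto dest: member_le_sum_list)

lemma coeff_prod_list:
  fixes ps :: "'a::comm_semiring_1 poly list"
  shows "coeff (prod_list ps) K =
    (\<Sum>ks | length ks = length ps \<and> sum_list ks = K. \<Prod>i<length ps. coeff (ps ! i) (ks ! i))"
proof (induction ps arbitrary: K)
  case Nil
  have "{ks :: nat list. ks = [] \<and> sum_list ks = K} = (if K = 0 then {[]} else {})" by auto
  thus ?case by auto
next
  case (Cons p ps)
  let ?S = "\<lambda>l K. {ks :: nat list. length ks = l \<and> sum_list ks = K}"
  have eq: "?S (Suc (length ps)) K = (\<lambda>(i, ks). i # ks) ` (SIGMA i:{..K}. ?S (length ps) (K - i))"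
    by (auto simp: length_Suc_conv image_iff)
  have "coeff (prod_list (p # ps)) K =
      (\<Sum>i\<le>K. \<Sum>ks\<in>?S (length ps) (K - i). coeff p i * (\<Prod>j<length ps. coeff (ps ! j) (ks ! j)))"
    by (simp add: coeff_mult Cons sum_distrib_left)
  also have "\<dots> = (\<Sum>(i,ks)\<in>(SIGMA i:{..K}. ?S (length ps) (K - i)).
       coeff p i * (\<Prod>j<length ps. coeff (ps ! j) (ks ! j)))"
    by (rule sum.Sigma) (auto simp: finite_nat_lists_sum)
  also have "\<dots> = (\<Sum>ks\<in>?S (Suc (length ps)) K. \<Prod>i<Suc (length ps). coeff ((p # ps) ! i) (ks ! i))"
    unfolding eq by (subst sum.reindex)
      (auto simp: inj_on_def prod.lessThan_Suc_shift intro!: sum.cong simp del: prod.lessThan_Suc)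
  finally show ?case by simp
qed

section \<open>Theta series as limits of finite products\<close>

lemma sum_list_eq_sum_nth: "sum_list xs = (\<Sum>i<length xs. xs ! i)"
  by (simp add: sum_list_sum_nth atLeast0LessThan)

lemma tendsto_qpoch:
  assumes "e > 0" "filterlim f at_top F"
  shows "((\<lambda>x. qpoch (fps_X ^ e :: 'a::field fps) (f x)) \<longlongrightarrow> euler_phi e) F"
  by (rule filterlim_compose[OF qpoch_tendsto_euler_phi[OF assms(1)] assms(2)])

lemma tendsto_rpoch:
  fixes f :: "'b \<Rightarrow> int"
  assumes "e > 0" "filterlim f at_top F"
  shows "((\<lambda>x. rpoch (fps_X ^ e :: 'a::field fps) (f x)) \<longlongrightarrow> inverse (euler_phi e)) F"
proof -
  have "filterlim (\<lambda>x. nat (f x)) at_top F"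
    unfolding filterlim_at_top
  proof
    fix Z :: nat
    have "\<forall>\<^sub>F x in F. f x \<ge> int Z" using assms(2) by (simp add: filterlim_at_top)
    thus "\<forall>\<^sub>F x in F. nat (f x) \<ge> Z" by eventually_elim linarith
  qed
  hence "((\<lambda>x. inverse (qpoch (fps_X ^ e :: 'a fps) (nat (f x)))) \<longlongrightarrow> inverse (euler_phi e)) F"
    by (intro tendsto_fps_inverse tendsto_qpoch assms(1)) (simp_all add: assms(1) euler_phi_nth_0)
  moreover have "\<forall>\<^sub>F x in F. rpoch (fps_X ^ e :: 'a fps) (f x) = inverse (qpoch (fps_X ^ e) (nat (f x)))"
  proof -
    have "\<forall>\<^sub>F x in F. f x \<ge> 0" using assms(2) by (simp add: filterlim_at_top)
    thus ?thesis by eventually_elim (simp add: rpoch_def)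
  qed
  ultimately show ?thesis by (simp add: tendsto_cong)
qed

lemma filterlim_int_mult_add: "\<mu> > 0 \<Longrightarrow> filterlim (\<lambda>M. int (\<mu> * M) + k) at_top sequentially"
  unfolding filterlim_at_top
proof
  fix Z :: int assume "\<mu> > 0"
  show "\<forall>\<^sub>F M in sequentially. Z \<le> int (\<mu> * M) + k"
  proof (rule eventually_mono[OF eventually_ge_at_top[of "nat (Z - k)"]])
    fix M assume "nat (Z - k) \<le> M"
    moreover have "M \<le> \<mu> * M" using \<open>\<mu> > 0\<close> by simp
    ultimately show "Z \<le> int (\<mu> * M) + k" by linarith
  qed
qed

text \<open>A pair (a, b) stands for the triple product with A = X^a and B = X^b. The value is the
  exponent of X in the term of multi-index ks of the product of the corresponding theta
  functions.\<close>

definition theta_exp :: "(nat \<times> nat) list \<Rightarrow> int list \<Rightarrow> nat" where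
  "theta_exp ab ks = (\<Sum>i<length ab. fst (ab ! i) * tri (ks ! i) + snd (ab ! i) * tri (ks ! i - 1))"

text \<open>The coefficient of z^k in that product of theta functions. For positive pairs the
  counted sets are finite, so the default value of \<open>card\<close> at infinite sets does not
  enter.\<close>

definition theta_fps :: "(nat \<times> nat) list \<Rightarrow> int \<Rightarrow> 'a::comm_semiring_1 fps" where
  "theta_fps ab k = Abs_fps (\<lambda>t. of_nat (card
     {ks. length ks = length ab \<and> sum_list ks = k \<and> theta_exp ab ks = t}))"

text \<open>The right-hand side is k^2. This crude bound is what makes the theta series, and later
  the specialization, finite in every degree.\<close>

lemma abs_le_tri_add: "\<bar>k\<bar> \<le> int (tri k + tri (k - 1))"
proof -
  have "int (tri k + tri (k - 1)) = k * k"
    using int_tri[of k] int_tri[of "k - 1"] by (simp add: algebra_simps)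
  moreover have "\<bar>k\<bar> * 1 \<le> \<bar>k\<bar> * \<bar>k\<bar>" by (cases "k = 0") (auto simp del: abs_mult_self_eq intro!: mult_left_mono)
  ultimately show ?thesis by (simp only: abs_mult_self_eq mult_1_right)
qed

lemma abs_nth_le_theta_exp:
  assumes pos: "\<forall>p\<in>set ab. 0 < fst p \<and> 0 < snd p" and i: "i < length ab"
  shows "\<bar>ks ! i\<bar> \<le> int (theta_exp ab ks)"
proof -
  let ?f = "\<lambda>i. fst (ab ! i) * tri (ks ! i) + snd (ab ! i) * tri (ks ! i - 1)"
  have p: "fst (ab ! i) \<ge> 1" "snd (ab ! i) \<ge> 1" using pos i by (auto simp: Suc_le_eq)
  have "tri (ks ! i) + tri (ks ! i - 1) \<le> ?f i"
    using mult_le_mono1[OF p(1), of "tri (ks ! i)"] mult_le_mono1[OF p(2), of "tri (ks ! i - 1)"] by linarith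
  also have "?f i \<le> theta_exp ab ks"
    unfolding theta_exp_def using i by (intro member_le_sum) auto
  finally show ?thesis using abs_le_tri_add[of "ks ! i"] by linarith
qed

lemma finite_theta_exp_le:
  assumes "\<forall>p\<in>set ab. 0 < fst p \<and> 0 < snd p"
  shows "finite {ks. length ks = length ab \<and> theta_exp ab ks \<le> t}"
proof (rule finite_subset[OF _ finite_lists_length_eq[of "{- int t..int t}" "length ab"]])
  show "{ks. length ks = length ab \<and> theta_exp ab ks \<le> t} \<subseteq>
      {ks. set ks \<subseteq> {- int t..int t} \<and> length ks = length ab}"
  proof safe
    fix ks :: "int list" and x
    assume ks: "length ks = length ab" "theta_exp ab ks \<le> t" "x \<in> set ks"
    then obtain i where "i < length ab" "x = ks ! i" by (auto simp: in_set_conv_nth)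
    hence "\<bar>x\<bar> \<le> int t" using abs_nth_le_theta_exp[OF assms, of i ks] ks by simp
    thus "x \<in> {- int t..int t}" by auto
  qed
qed simp

text \<open>Grouping the lists by their exponent turns the Cauchy product into a sum over lists.
  Both the truncated triple products and the specialized lattice quotient arrive in this
  form.\<close>

lemma theta_fps_mult_nth:
  fixes \<Phi> :: "'a::comm_semiring_1 fps"
  assumes "\<forall>p\<in>set ab. 0 < fst p \<and> 0 < snd p"
  shows "fps_nth (theta_fps ab k * \<Phi>) t =
    (\<Sum>ks | length ks = length ab \<and> sum_list ks = k \<and> theta_exp ab ks \<le> t.
       fps_nth \<Phi> (t - theta_exp ab ks))"
proof -
  let ?T = "{ks. length ks = length ab \<and> sum_list ks = k \<and> theta_exp ab ks \<le> t}"
  have fin: "finite ?T" by (rule finite_subset[OF _ finite_theta_exp_le[OF assms, of t]]) auto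
  have "(\<Sum>ks\<in>?T. fps_nth \<Phi> (t - theta_exp ab ks)) =
      (\<Sum>s\<in>{0..t}. \<Sum>ks | ks \<in> ?T \<and> theta_exp ab ks = s. fps_nth \<Phi> (t - theta_exp ab ks))"
    by (rule sum.group[symmetric]) (use fin in auto)
  also have "\<dots> = (\<Sum>s\<in>{0..t}. fps_nth (theta_fps ab k) s * fps_nth \<Phi> (t - s))"
  proof (intro sum.cong refl)
    fix s assume "s \<in> {0..t}"
    hence "{ks. ks \<in> ?T \<and> theta_exp ab ks = s} =
        {ks. length ks = length ab \<and> sum_list ks = k \<and> theta_exp ab ks = s}" by auto
    moreover have "(\<Sum>ks | ks \<in> ?T \<and> theta_exp ab ks = s. fps_nth \<Phi> (t - theta_exp ab ks)) =
        (\<Sum>ks | ks \<in> ?T \<and> theta_exp ab ks = s. fps_nth \<Phi> (t - s))" by (intro sum.cong) auto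
    ultimately show "(\<Sum>ks | ks \<in> ?T \<and> theta_exp ab ks = s. fps_nth \<Phi> (t - theta_exp ab ks)) =
        fps_nth (theta_fps ab k) s * fps_nth \<Phi> (t - s)" by (simp add: theta_fps_def)
  qed
  finally show ?thesis by (simp add: fps_mult_nth)
qed

text \<open>By the finite triple product, the coefficient is a finite sum of powers of X times
  Gaussian binomials, which tend to inverse Euler products for each fixed multi-index. In a fixed
  degree t only finitely many multi-indices matter, so the limit may be taken termwise. The rates
  \<open>\<mu> i\<close> are free, so that factorizations of one polynomial into different numbers
  of factors can be compared.\<close>

lemma jtp_product_tendsto:
  fixes ab :: "(nat \<times> nat) list" and \<mu> :: "nat \<Rightarrow> nat" and k :: nat
  assumes pos: "\<forall>p\<in>set ab. 0 < fst p \<and> 0 < snd p" and \<mu>: "\<And>i. i < length ab \<Longrightarrow> \<mu> i > 0"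
  shows "(\<lambda>M. coeff (\<Prod>i<length ab.
            jtp_poly (fps_X ^ fst (ab ! i)) (fps_X ^ snd (ab ! i)) (\<mu> i * M) (\<mu> i * M))
            (k + (\<Sum>i<length ab. \<mu> i * M)))
         \<longlonglongrightarrow> theta_fps ab (int k) * (\<Prod>i<length ab. inverse (euler_phi (fst (ab ! i) + snd (ab ! i)) :: 'a::field fps))"
    (is "?C \<longlonglongrightarrow> _ * ?\<Phi>")
proof (rule tendsto_fpsI)
  fix t
  define l where "l = length ab"
  define e where "e i = fst (ab ! i) + snd (ab ! i)" for i
  have e: "e i > 0" if "i < l" for i using pos that unfolding e_def l_def by (metis nth_mem add_pos_pos)
  \<comment> \<open>The Gaussian binomials seen from their centres: the i-th one is that of 2
    \<open>\<mu> i\<close> M over \<open>\<mu> i\<close> M + \<open>ks ! i\<close>, with limit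
    \<phi> / (\<phi> \<phi>) = 1 / \<phi>, where \<phi> is \<open>euler_phi (e i)\<close>.\<close>
  define G :: "nat \<Rightarrow> int list \<Rightarrow> 'a fps" where "G M ks = (\<Prod>i<l. qpoch (fps_X ^ e i) (\<mu> i * M + \<mu> i * M) *
      rpoch (fps_X ^ e i) (int (\<mu> i * M) - ks ! i) * rpoch (fps_X ^ e i) (int (\<mu> i * M) + ks ! i))" for M ks
  have G: "(\<lambda>M. G M ks) \<longlonglongrightarrow> ?\<Phi>" for ks
    unfolding G_def l_def[symmetric] e_def[symmetric]
  proof (rule tendsto_fps_prod)
    fix i assume "i \<in> {..<l}"
    hence i: "e i > 0" "\<mu> i > 0" using e \<mu> by (auto simp: l_def)
    have "filterlim (\<lambda>M. int (\<mu> i * M) - ks ! i) at_top sequentially"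
      using filterlim_int_mult_add[OF i(2), of "- (ks ! i)"] by simp
    moreover have "filterlim (\<lambda>M. \<mu> i * M + \<mu> i * M) at_top sequentially"
    proof (rule filterlim_at_top_mono[OF filterlim_ident])
      have "M \<le> \<mu> i * M + \<mu> i * M" for M using i(2) by (simp add: trans_le_add1)
      thus "\<forall>\<^sub>F M in sequentially. M \<le> \<mu> i * M + \<mu> i * M" by simp
    qed
    ultimately have "(\<lambda>M. qpoch (fps_X ^ e i :: 'a fps) (\<mu> i * M + \<mu> i * M) *
        rpoch (fps_X ^ e i) (int (\<mu> i * M) - ks ! i) * rpoch (fps_X ^ e i) (int (\<mu> i * M) + ks ! i))
        \<longlonglongrightarrow> euler_phi (e i) * inverse (euler_phi (e i)) * inverse (euler_phi (e i))"
      by (intro tendsto_fps_mult tendsto_qpoch tendsto_rpoch i filterlim_int_mult_add)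
    also have "fps_nth (euler_phi (e i) :: 'a fps) 0 \<noteq> 0" using i by (simp add: euler_phi_nth_0)
    hence "euler_phi (e i) * inverse (euler_phi (e i)) = (1 :: 'a fps)"
      by (rule inverse_mult_eq_1')
    finally show "(\<lambda>M. qpoch (fps_X ^ e i :: 'a fps) (\<mu> i * M + \<mu> i * M) *
        rpoch (fps_X ^ e i) (int (\<mu> i * M) - ks ! i) * rpoch (fps_X ^ e i) (int (\<mu> i * M) + ks ! i))
        \<longlonglongrightarrow> inverse (euler_phi (e i))" by simp
  qed
  define S where "S M = {js :: nat list. length js = l \<and> sum_list js = k + (\<Sum>i<l. \<mu> i * M)}" for M
  \<comment> \<open>Only lower bounds are imposed. If an index exceeds \<open>\<mu> i * M\<close>,
    then a factor \<open>rpoch\<close> of G has a negative argument and the term is 0.\<close>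
  define J where "J M = {ks :: int list. length ks = l \<and> sum_list ks = int k \<and>
      (\<forall>i<l. ks ! i + int (\<mu> i * M) \<ge> 0)}" for M
  \<comment> \<open>The shift from powers of z in the polynomial factors to indices of the bilateral
    series.\<close>
  define sh where "sh M js = map (\<lambda>i. int (js ! i) - int (\<mu> i * M)) [0..<l]" for M and js :: "nat list"
  have bij: "bij_betw (sh M) (S M) (J M)" for M
  proof (rule bij_betw_byWitness[where f' = "\<lambda>ks. map (\<lambda>i. nat (ks ! i + int (\<mu> i * M))) [0..<l]"])
    show "\<forall>js\<in>S M. map (\<lambda>i. nat (sh M js ! i + int (\<mu> i * M))) [0..<l] = js"
      by (auto simp: S_def sh_def intro!: nth_equalityI)
    show "\<forall>ks\<in>J M. sh M (map (\<lambda>i. nat (ks ! i + int (\<mu> i * M))) [0..<l]) = ks"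
      by (auto simp: J_def sh_def intro!: nth_equalityI)
    show "sh M ` S M \<subseteq> J M"
    proof safe
      fix js assume js: "js \<in> S M"
      have "int (sum_list js) = int (k + (\<Sum>i<l. \<mu> i * M))" using js by (simp add: S_def)
      hence "(\<Sum>i<l. int (js ! i)) - (\<Sum>i<l. int (\<mu> i * M)) = int k"
        using js by (simp add: S_def sum_list_eq_sum_nth)
      thus "sh M js \<in> J M"
        by (simp add: J_def sh_def sum_list_eq_sum_nth sum_subtractf)
    qed
    show "(\<lambda>ks. map (\<lambda>i. nat (ks ! i + int (\<mu> i * M))) [0..<l]) ` J M \<subseteq> S M"
    proof safe
      fix ks assume ks: "ks \<in> J M"
      have "int (\<Sum>i<l. nat (ks ! i + int (\<mu> i * M))) = (\<Sum>i<l. ks ! i + int (\<mu> i * M))"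
        unfolding of_nat_sum using ks by (intro sum.cong refl) (auto simp: J_def)
      also have "\<dots> = int (k + (\<Sum>i<l. \<mu> i * M))"
        using ks by (auto simp: J_def sum_list_eq_sum_nth sum.distrib)
      finally have "(\<Sum>i<l. nat (ks ! i + int (\<mu> i * M))) = k + (\<Sum>i<l. \<mu> i * M)"
        by (simp only: of_nat_eq_iff)
      thus "map (\<lambda>i. nat (ks ! i + int (\<mu> i * M))) [0..<l] \<in> S M"
        by (simp add: S_def sum_list_eq_sum_nth)
    qed
  qed
  have coeff_C: "?C M = (\<Sum>ks\<in>J M. fps_X ^ theta_exp ab ks * G M ks)" for M
  proof -
    let ?p = "\<lambda>i. jtp_poly (fps_X ^ fst (ab ! i)) (fps_X ^ snd (ab ! i)) (\<mu> i * M) (\<mu> i * M) :: 'a fps poly"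
    have "?C M = coeff (prod_list (map ?p [0..<l])) (k + (\<Sum>i<l. \<mu> i * M))"
      by (simp add: l_def prod.list_conv_set_nth atLeast0LessThan)
    also have "\<dots> = (\<Sum>js\<in>S M. \<Prod>i<l. coeff (?p i) (js ! i))"
      by (simp add: coeff_prod_list S_def)
    also have "\<dots> = (\<Sum>js\<in>S M. fps_X ^ theta_exp ab (sh M js) * G M (sh M js))"
    proof (intro sum.cong refl)
      fix js assume "js \<in> S M"
      have "coeff (?p i) (js ! i) = fps_X ^ (fst (ab ! i) * tri (sh M js ! i) + snd (ab ! i) * tri (sh M js ! i - 1)) *
         (qpoch (fps_X ^ e i) (\<mu> i * M + \<mu> i * M) *
         rpoch (fps_X ^ e i) (int (\<mu> i * M) - sh M js ! i) * rpoch (fps_X ^ e i) (int (\<mu> i * M) + sh M js ! i))"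
        if i: "i < l" for i
      proof -
        have c0: "fps_nth (fps_X ^ fst (ab ! i) * fps_X ^ snd (ab ! i) :: 'a fps) 0 = 0"
          using e[OF i] by (simp add: e_def flip: power_add)
        have "int (\<mu> i * M + \<mu> i * M) - int (js ! i) = int (\<mu> i * M) - sh M js ! i"
             "int (js ! i) = int (\<mu> i * M) + sh M js ! i"
             "int (js ! i) - int (\<mu> i * M) = sh M js ! i"
          using i by (simp_all add: sh_def)
        thus ?thesis unfolding coeff_jtp_poly[OF c0] jtp_coeff_def
          by (simp only: e_def power_add power_mult mult.assoc)
      qed
      thus "(\<Prod>i<l. coeff (?p i) (js ! i)) = fps_X ^ theta_exp ab (sh M js) * G M (sh M js)"
        by (simp add: G_def theta_exp_def power_sum prod.distrib flip: l_def)
    qed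
    also have "\<dots> = (\<Sum>ks\<in>J M. fps_X ^ theta_exp ab ks * G M ks)"
      by (rule sum.reindex_bij_betw[OF bij])
    finally show ?thesis .
  qed
  define T where "T = {ks. length ks = length ab \<and> sum_list ks = int k \<and> theta_exp ab ks \<le> t}"
  have finT: "finite T"
    unfolding T_def by (rule finite_subset[OF _ finite_theta_exp_le[OF pos, of t]]) auto
  have finJ: "finite (J M)" for M
    using bij_betw_finite[OF bij, of M] finite_nat_lists_sum by (simp add: S_def)
  \<comment> \<open>A multi-index of exponent at most t has entries of absolute value at most t,
    hence it lies within the truncation as soon as M \<ge> t.\<close>
  have TJ: "T \<subseteq> J M" if "M \<ge> t" for M
  proof
    fix ks assume ks: "ks \<in> T"
    have "ks ! i + int (\<mu> i * M) \<ge> 0" if i: "i < l" for i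
    proof -
      have "\<bar>ks ! i\<bar> \<le> int t"
        using abs_nth_le_theta_exp[OF pos, of i ks] ks i by (simp add: T_def l_def)
      moreover have "M \<le> \<mu> i * M" using \<mu>[of i] i by (simp add: l_def)
      ultimately show ?thesis using \<open>M \<ge> t\<close> by linarith
    qed
    thus "ks \<in> J M" using ks by (simp add: T_def J_def l_def)
  qed
  have "\<forall>\<^sub>F M in sequentially. \<forall>ks\<in>T. fps_nth (G M ks) (t - theta_exp ab ks) = fps_nth ?\<Phi> (t - theta_exp ab ks)"
    using G by (intro eventually_ball_finite finT) (simp add: tendsto_fps_iff)
  with eventually_ge_at_top[of t]
  show "\<forall>\<^sub>F M in sequentially. fps_nth (?C M) t = fps_nth (theta_fps ab (int k) * ?\<Phi>) t"
  proof eventually_elim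
    case (elim M)
    have "fps_nth (?C M) t = (\<Sum>ks\<in>J M. fps_nth (fps_X ^ theta_exp ab ks * G M ks) t)"
      by (simp add: coeff_C fps_sum_nth)
    also have "\<dots> = (\<Sum>ks\<in>T. fps_nth (fps_X ^ theta_exp ab ks * G M ks) t)"
      by (rule sum.mono_neutral_right[OF finJ TJ[OF elim(1)]])
        (auto simp: J_def T_def l_def fps_X_power_mult_nth)
    also have "\<dots> = (\<Sum>ks\<in>T. fps_nth ?\<Phi> (t - theta_exp ab ks))"
      using elim(2) by (intro sum.cong refl) (auto simp: fps_X_power_mult_nth T_def)
    finally show ?case by (simp add: theta_fps_mult_nth[OF pos] T_def)
  qed
qed

section \<open>Residue classes and the two factorizations\<close>

lemma prod_split_residues:
  "(\<Prod>t<a * M. f t) = (\<Prod>j<a. \<Prod>i<M. f (a * i + j :: nat))" for f :: "nat \<Rightarrow> 'a::comm_monoid_mult"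
proof -
  have "(\<Prod>t<a * M. f t) = (\<Prod>i<M. prod f {i * a..<i * a + a})"
    by (simp add: prod.nat_group mult.commute)
  also have "\<dots> = (\<Prod>i<M. \<Prod>j<a. f (a * i + j))"
  proof (rule prod.cong[OF refl])
    fix i
    show "prod f {i * a..<i * a + a} = (\<Prod>j<a. f (a * i + j))"
      using prod.atLeastLessThan_shift_0[of f "i * a" "i * a + a"]
      by (simp add: atLeast0LessThan comp_def mult.commute)
  qed
  finally show ?thesis by (subst prod.swap)
qed

text \<open>In the triple product with A = B = X^d, the factors in z of index congruent to j modulo
  a start at X^(d(2j+1)) and advance by X^(2da). A triple product has step A B, so the first
  exponents of its two kinds must add up to 2 d a. This forces the residue a - 1 - j for the second
  kind.\<close>

definition principal_block :: "nat \<Rightarrow> nat \<Rightarrow> (nat \<times> nat) list" where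
  "principal_block d a = map (\<lambda>j. (d * (2 * j + 1), d * (2 * (a - Suc j) + 1))) [0..<a]"

text \<open>Sorting the factors of a triple product by the residue of their index modulo a.\<close>

lemma jtp_poly_principal_block:
  "(\<Prod>p\<leftarrow>principal_block d a. jtp_poly (fps_X ^ fst p) (fps_X ^ snd p) M M) =
   jtp_poly (fps_X ^ d) (fps_X ^ d :: 'a::comm_ring_1 fps) (a * M) (a * M)"
proof -
  have split1: "(\<Prod>t<a * M. [:1, fps_X ^ (d * (2 * t + 1)):]) =
      (\<Prod>j<a. \<Prod>i<M. [:1, fps_X ^ (d * (2 * (a * i + j) + 1)):] :: 'a fps poly)"
    by (rule prod_split_residues)
  have "(\<Prod>t<a * M. [:fps_X ^ (d * (2 * t + 1)), 1:]) =
      (\<Prod>j<a. \<Prod>i<M. [:fps_X ^ (d * (2 * (a * i + j) + 1)), 1:] :: 'a fps poly)"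
    by (rule prod_split_residues)
  \<comment> \<open>Reversing the order of the residues brings each class of the first kind together
    with its opposite class of the second kind.\<close>
  also have "\<dots> = (\<Prod>j<a. \<Prod>i<M. [:fps_X ^ (d * (2 * (a * i + (a - Suc j)) + 1)), 1:])"
    by (rule prod.nat_diff_reindex[symmetric])
  finally have split2: "(\<Prod>t<a * M. [:fps_X ^ (d * (2 * t + 1)), 1:]) =
      (\<Prod>j<a. \<Prod>i<M. [:fps_X ^ (d * (2 * (a * i + (a - Suc j)) + 1)), 1:] :: 'a fps poly)" .
  have pw: "fps_X ^ u * (fps_X ^ u * fps_X ^ v) ^ t = (fps_X ^ (u + (u + v) * t) :: 'a fps)"
    "fps_X ^ v * (fps_X ^ u * fps_X ^ v) ^ t = (fps_X ^ (v + (u + v) * t) :: 'a fps)" for u v t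
    by (simp_all only: power_add power_mult)
  have e1: "d + (d + d) * t = d * (2 * t + 1)" for t by (simp add: algebra_simps)
  have "(\<Prod>p\<leftarrow>principal_block d a. jtp_poly (fps_X ^ fst p) (fps_X ^ snd p) M M) =
    (\<Prod>j<a. jtp_poly (fps_X ^ (d * (2 * j + 1))) (fps_X ^ (d * (2 * (a - Suc j) + 1))) M M :: 'a fps poly)"
    by (simp add: principal_block_def prod.list_conv_set_nth atLeast0LessThan)
  also have "\<dots> = (\<Prod>j<a. (\<Prod>i<M. [:1, fps_X ^ (d * (2 * (a * i + j) + 1)):]) *
      (\<Prod>i<M. [:fps_X ^ (d * (2 * (a * i + (a - Suc j)) + 1)), 1:]))"
  proof (intro prod.cong refl)
    fix j assume "j \<in> {..<a}"
    then obtain b where b: "a = Suc j + b" by (auto simp: less_iff_Suc_add)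
    have eqs: "d * (2 * j + 1) + (d * (2 * j + 1) + d * (2 * (a - Suc j) + 1)) * i = d * (2 * (a * i + j) + 1)"
      "d * (2 * (a - Suc j) + 1) + (d * (2 * j + 1) + d * (2 * (a - Suc j) + 1)) * i = d * (2 * (a * i + (a - Suc j)) + 1)" for i
      unfolding b by (simp_all add: algebra_simps)
    show "jtp_poly (fps_X ^ (d * (2 * j + 1))) (fps_X ^ (d * (2 * (a - Suc j) + 1))) M M =
      (\<Prod>i<M. [:1, fps_X ^ (d * (2 * (a * i + j) + 1)):]) *
      (\<Prod>i<M. [:fps_X ^ (d * (2 * (a * i + (a - Suc j)) + 1)), 1 :: 'a fps:])"
      by (simp only: jtp_poly_def pw eqs)
  qed
  also have "\<dots> = jtp_poly (fps_X ^ d) (fps_X ^ d) (a * M) (a * M)"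
    unfolding jtp_poly_def pw e1 prod.distrib split1 split2 ..
  finally show ?thesis .
qed

definition principal_list :: "nat \<Rightarrow> nat list \<Rightarrow> (nat \<times> nat) list" where
  "principal_list N ns = concat (map (\<lambda>a. principal_block (N div a) a) ns)"

text \<open>The sum 2 N is the same for all n pairs, whatever block they come from. So all n triple
  products share the base X^(2 N) = q^N, and their Euler products combine into a single
  power.\<close>

lemma principal_list_facts:
  assumes N: "N > 0" and ns: "\<And>a. a \<in> set ns \<Longrightarrow> a dvd N"
  shows "length (principal_list N ns) = sum_list ns"
    and "p \<in> set (principal_list N ns) \<Longrightarrow> 0 < fst p \<and> 0 < snd p \<and> fst p + snd p = 2 * N"
proof -
  show "length (principal_list N ns) = sum_list ns"
    by (simp add: principal_list_def length_concat principal_block_def comp_def)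
  assume p: "p \<in> set (principal_list N ns)"
  obtain a j where a: "a \<in> set ns" "j < a" and
    pj: "p = (N div a * (2 * j + 1), N div a * (2 * (a - Suc j) + 1))"
    using p by (auto simp: principal_list_def principal_block_def)
  have "fst p + snd p = N div a * (2 * j + 1 + (2 * (a - Suc j) + 1))"
    unfolding pj by (simp only: fst_conv snd_conv distrib_left)
  also have "2 * j + 1 + (2 * (a - Suc j) + 1) = a * 2" using a(2) by simp
  finally have "fst p + snd p = 2 * N" using ns[OF a(1)] by (simp flip: mult.assoc)
  moreover have "N div a > 0" using ns[OF a(1)] N by (auto elim!: dvdE)
  ultimately show "0 < fst p \<and> 0 < snd p \<and> fst p + snd p = 2 * N" by (simp add: pj)
qed

text \<open>Both sides are limits of the same coefficient of one polynomial, which is factored in two ways.\<close>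

lemma theta_principal_blocks:
  fixes ns :: "nat list"
  assumes N: "N > 0" and dvd: "\<And>a. a \<in> set ns \<Longrightarrow> a dvd N"
  shows "theta_fps (principal_list N ns) (int k) * inverse (euler_phi (2 * N)) ^ sum_list ns =
    theta_fps (map (\<lambda>a. (N div a, N div a)) ns) (int k) *
      (\<Prod>i<length ns. inverse (euler_phi (2 * (N div ns ! i)) :: 'a::field fps))"
proof (rule LIMSEQ_unique)
  define ab where "ab = principal_list N ns"
  define J where "J M p = (jtp_poly (fps_X ^ fst p) (fps_X ^ snd p) M M :: 'a fps poly)" for M p
  define C where "C M = coeff (prod_list (map (J M) ab)) (k + sum_list ns * M)" for M
  have d: "N div a > 0" "a > 0" if "a \<in> set ns" for a
    using dvd[OF that] N by (auto elim!: dvdE)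
  have len: "length ab = sum_list ns"
    and ab: "\<And>p. p \<in> set ab \<Longrightarrow> 0 < fst p \<and> 0 < snd p \<and> fst p + snd p = 2 * N"
    using principal_list_facts[OF N dvd] by (simp_all add: ab_def)
  \<comment> \<open>The finer factorization: n triple products of base X^(2 N), all truncated at
    M.\<close>
  have "(\<lambda>M. coeff (\<Prod>i<length ab. jtp_poly (fps_X ^ fst (ab ! i)) (fps_X ^ snd (ab ! i)) (1 * M) (1 * M))
        (k + (\<Sum>i<length ab. 1 * M)))
      \<longlonglongrightarrow> theta_fps ab (int k) * (\<Prod>i<length ab. inverse (euler_phi (fst (ab ! i) + snd (ab ! i)) :: 'a fps))"
    by (rule jtp_product_tendsto) (use ab in auto)
  also have "(\<lambda>M. coeff (\<Prod>i<length ab. jtp_poly (fps_X ^ fst (ab ! i)) (fps_X ^ snd (ab ! i)) (1 * M) (1 * M))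
        (k + (\<Sum>i<length ab. 1 * M))) = C"
    by (simp add: C_def[abs_def] J_def prod.list_conv_set_nth atLeast0LessThan len)
  also have "(\<Prod>i<length ab. inverse (euler_phi (fst (ab ! i) + snd (ab ! i)) :: 'a fps)) =
      (\<Prod>i<length ab. inverse (euler_phi (2 * N)))"
    by (intro prod.cong refl) (use ab in \<open>metis nth_mem lessThan_iff\<close>)
  also have "\<dots> = inverse (euler_phi (2 * N)) ^ sum_list ns" by (simp add: len)
  finally show "C \<longlonglongrightarrow> theta_fps (principal_list N ns) (int k) * inverse (euler_phi (2 * N)) ^ sum_list ns"
    unfolding ab_def .
  let ?r = "map (\<lambda>a. (N div a, N div a)) ns"
  \<comment> \<open>The coarser factorization: one triple product per part a. Truncating it at a M
    gives exactly the factors of the a triple products of its block, and the centre is again n M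
    because the parts add up to n.\<close>
  have "(\<lambda>M. coeff (\<Prod>i<length ?r. jtp_poly (fps_X ^ fst (?r ! i)) (fps_X ^ snd (?r ! i)) (ns ! i * M) (ns ! i * M))
        (k + (\<Sum>i<length ?r. ns ! i * M)))
      \<longlonglongrightarrow> theta_fps ?r (int k) * (\<Prod>i<length ?r. inverse (euler_phi (fst (?r ! i) + snd (?r ! i)) :: 'a fps))"
    by (rule jtp_product_tendsto) (use d in auto)
  also have "(\<lambda>M. coeff (\<Prod>i<length ?r. jtp_poly (fps_X ^ fst (?r ! i)) (fps_X ^ snd (?r ! i)) (ns ! i * M) (ns ! i * M))
        (k + (\<Sum>i<length ?r. ns ! i * M))) = C"
  proof
    fix M
    have "(\<Prod>i<length ?r. jtp_poly (fps_X ^ fst (?r ! i)) (fps_X ^ snd (?r ! i)) (ns ! i * M) (ns ! i * M)) =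
       (\<Prod>a\<leftarrow>ns. jtp_poly (fps_X ^ (N div a)) (fps_X ^ (N div a)) (a * M) (a * M) :: 'a fps poly)"
      by (simp add: prod.list_conv_set_nth atLeast0LessThan)
    also have "\<dots> = (\<Prod>a\<leftarrow>ns. prod_list (map (J M) (principal_block (N div a) a)))"
      by (simp only: J_def[abs_def] jtp_poly_principal_block)
    also have "\<dots> = prod_list (map (J M) ab)"
      unfolding ab_def principal_list_def by (induction ns) auto
    finally show "coeff (\<Prod>i<length ?r. jtp_poly (fps_X ^ fst (?r ! i)) (fps_X ^ snd (?r ! i)) (ns ! i * M) (ns ! i * M))
        (k + (\<Sum>i<length ?r. ns ! i * M)) = C M"
      by (simp add: C_def sum_list_eq_sum_nth sum_distrib_right)
  qed
  also have "(\<Prod>i<length ?r. inverse (euler_phi (fst (?r ! i) + snd (?r ! i)))) =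
     (\<Prod>i<length ns. inverse (euler_phi (2 * (N div ns ! i)) :: 'a fps))"
    by (simp add: mult_2)
  finally show "C \<longlonglongrightarrow> theta_fps ?r (int k) * (\<Prod>i<length ns. inverse (euler_phi (2 * (N div ns ! i))))" .
qed

section \<open>Series in fractional powers of q\<close>

text \<open>The series in q with exponents in b + (1/2) \<nat>, written as a power series in the square root of q.\<close>

definition half_series :: "rat \<Rightarrow> complex fps \<Rightarrow> rat fser" where
  "half_series b F x = (if \<exists>j::nat. x = b + of_nat j / 2 then fps_nth F (nat \<lfloor>2 * (x - b)\<rfloor>) else 0)"

lemma half_series_at: "half_series b F (b + of_nat j / 2) = fps_nth F j"
  by (auto simp: half_series_def)

lemma half_series_nonzeroD: "half_series b F x \<noteq> 0 \<Longrightarrow> \<exists>j. x = b + of_nat j / 2"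
  by (auto simp: half_series_def split: if_splits)

lemma half_series_eqI:
  assumes "\<And>j. f (b + of_nat j / 2) = fps_nth F j" "\<And>x. f x \<noteq> 0 \<Longrightarrow> \<exists>j::nat. x = b + of_nat j / 2"
  shows "f = half_series b F"
proof
  fix x
  show "f x = half_series b F x"
  proof (cases "\<exists>j::nat. x = b + of_nat j / 2")
    case True
    thus ?thesis using assms(1) half_series_at by (metis (no_types))
  next
    case False
    thus ?thesis using assms(2)[of x] half_series_nonzeroD[of b F x] by argo
  qed
qed

text \<open>The supports are bounded below with spacing 1/2, so every coefficient is a finite Cauchy
  sum and the default value in \<open>fmult\<close> never applies. Products in the final identity
  thus reduce to products of power series.\<close>

lemma half_series_mult: "half_series b F \<star> half_series c G = half_series (b + c) (F * G)"
proof (rule half_series_eqI)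
  fix t :: nat
  define x where "x = b + c + of_nat t / (2::rat)"
  let ?f = "\<lambda>i::nat. b + of_nat i / 2"
  have inj: "inj_on ?f A" for A by (auto simp: inj_on_def)
  have x_diff: "x - ?f i = c + of_nat (t - i) / 2" if "i \<le> t" for i
    using that by (simp add: x_def of_nat_diff field_simps)
  have "(half_series b F \<star> half_series c G) x = (\<Sum>y\<in>?f ` {0..t}. half_series b F y * half_series c G (x - y))"
    unfolding fmult_def
  proof (rule sum.mono_neutral_left)
    show "{y. half_series b F y \<noteq> 0 \<and> half_series c G (x - y) \<noteq> 0} \<subseteq> ?f ` {0..t}"
    proof
      fix y assume "y \<in> {y. half_series b F y \<noteq> 0 \<and> half_series c G (x - y) \<noteq> 0}"
      then obtain i j where ij: "y = ?f i" "x - y = c + of_nat j / 2"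
        using half_series_nonzeroD by blast
      hence "of_nat (i + j) = (of_nat t :: rat)" by (simp add: x_def field_simps)
      hence "i + j = t" by (simp only: of_nat_eq_iff)
      thus "y \<in> ?f ` {0..t}" using ij by auto
    qed
  qed auto
  also have "\<dots> = (\<Sum>i=0..t. half_series b F (?f i) * half_series c G (x - ?f i))"
    using inj by (subst sum.reindex) simp_all
  also have "\<dots> = (\<Sum>i=0..t. fps_nth F i * fps_nth G (t - i))"
  proof (intro sum.cong refl)
    fix i assume "i \<in> {0..t}"
    hence "x - ?f i = c + of_nat (t - i) / 2" by (intro x_diff) simp
    thus "half_series b F (?f i) * half_series c G (x - ?f i) = fps_nth F i * fps_nth G (t - i)"
      by (simp only: half_series_at)
  qed
  finally show "(half_series b F \<star> half_series c G) (b + c + of_nat t / 2) = fps_nth (F * G) t"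
    by (simp add: x_def fps_mult_nth)
next
  fix x assume "(half_series b F \<star> half_series c G) x \<noteq> 0"
  then obtain y where "y \<in> {y. half_series b F y \<noteq> 0 \<and> half_series c G (x - y) \<noteq> 0}"
    unfolding fmult_def by (rule sum.not_neutral_contains_not_neutral)
  hence "half_series b F y \<noteq> 0" "half_series c G (x - y) \<noteq> 0" by simp_all
  then obtain i j where "y = b + of_nat i / 2" "x - y = c + of_nat j / 2"
    using half_series_nonzeroD by blast
  hence "x = b + c + of_nat (i + j) / 2" by (simp add: field_simps)
  thus "\<exists>j::nat. x = b + c + of_nat j / 2" by blast
qed

lemma fexp_eq_half_series: "fexp u = half_series u 1"
proof (rule half_series_eqI)
  fix x assume "fexp u x \<noteq> 0"
  hence "x = u + of_nat 0 / 2" by (simp add: fexp_def split: if_splits)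
  thus "\<exists>j::nat. x = u + of_nat j / 2" by blast
qed (simp add: fexp_def)

lemma fps_at_eq_half_series: "fps_at 1 P = half_series 0 (P oo fps_X ^ 2)"
proof (rule half_series_eqI)
  fix j :: nat
  have "{i. (\<Sum>_<i. 1) = 0 + of_nat j / (2::rat) \<and> fps_nth P i \<noteq> 0} =
      (if even j \<and> fps_nth P (j div 2) \<noteq> 0 then {j div 2} else {})"
  proof -
    have "(\<Sum>_<i. 1) = 0 + of_nat j / (2::rat) \<longleftrightarrow> 2 * i = j" for i
    proof -
      have "(\<Sum>_<i. 1) = 0 + of_nat j / (2::rat) \<longleftrightarrow> of_nat (2 * i) = (of_nat j :: rat)"
        by (simp add: field_simps)
      thus ?thesis by (simp only: of_nat_eq_iff)
    qed
    hence "{i. (\<Sum>_<i. 1) = 0 + of_nat j / (2::rat) \<and> fps_nth P i \<noteq> 0} = {i. 2 * i = j \<and> fps_nth P i \<noteq> 0}"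
      by (simp only:)
    also have "\<dots> = (if even j \<and> fps_nth P (j div 2) \<noteq> 0 then {j div 2} else {})"
      by (auto elim!: evenE)
    finally show ?thesis .
  qed
  thus "fps_at 1 P (0 + of_nat j / (2::rat)) = fps_nth (P oo fps_X ^ 2) j"
    unfolding fps_at_def by (simp only:) (simp add: fps_nth_compose_X_power)
next
  fix x :: rat assume "fps_at 1 P x \<noteq> 0"
  then obtain j where "j \<in> {j. (\<Sum>_<j. 1) = x \<and> fps_nth P j \<noteq> 0}"
    unfolding fps_at_def by (rule sum.not_neutral_contains_not_neutral)
  hence "x = 0 + of_nat (2 * j) / 2" by simp
  thus "\<exists>j::nat. x = 0 + of_nat j / 2" by blast
qed

text \<open>For equal entries of a pair the linear terms cancel: \<open>tri k + tri (k - 1)\<close>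
  is k^2. This is how the purely quadratic exponents of \<open>theta_sum\<close> arise.\<close>

lemma theta_exp_diagonal:
  "int (theta_exp (map (\<lambda>a. (d a, d a)) ns) ks) = (\<Sum>i<length ns. int (d (ns ! i)) * (ks ! i)\<^sup>2)"
proof -
  have "int (tri k) + int (tri (k - 1)) = k\<^sup>2" for k
    using int_tri[of k] int_tri[of "k - 1"] by (simp add: algebra_simps power2_eq_square)
  thus ?thesis by (simp add: theta_exp_def flip: distrib_left)
qed

lemma theta_sum_eq_half_series:
  assumes dvd: "\<And>a. a \<in> set ns \<Longrightarrow> a dvd part_N ns" and pos: "\<And>a. a \<in> set ns \<Longrightarrow> a > 0"
  shows "theta_sum ns k =
    half_series 0 (theta_fps (map (\<lambda>a. (part_N ns div a, part_N ns div a)) ns) (int k))"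
proof -
  let ?ab = "map (\<lambda>a. (part_N ns div a, part_N ns div a)) ns"
  have expo: "of_nat (part_N ns) / 2 * (\<Sum>i<length ns. of_int (ks ! i) ^ 2 / of_nat (ns ! i)) =
      (of_nat (theta_exp ?ab ks) / 2 :: rat)" for ks
  proof -
    have "(of_nat (theta_exp ?ab ks) :: rat) = of_int (int (theta_exp ?ab ks))" by simp
    also have "\<dots> = (\<Sum>i<length ns. of_nat (part_N ns div ns ! i) * of_int (ks ! i) ^ 2)"
      unfolding theta_exp_diagonal by simp
    also have "\<dots> = (\<Sum>i<length ns. of_nat (part_N ns) * (of_int (ks ! i) ^ 2 / of_nat (ns ! i)))"
    proof (intro sum.cong refl)
      fix i assume "i \<in> {..<length ns}"
      hence "ns ! i \<in> set ns" by simp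
      hence "ns ! i dvd part_N ns" and gt: "ns ! i > 0" using dvd pos by blast+
      then obtain q where "part_N ns = ns ! i * q" by (auto elim: dvdE)
      thus "of_nat (part_N ns div ns ! i) * of_int (ks ! i) ^ 2 =
          (of_nat (part_N ns) * (of_int (ks ! i) ^ 2 / of_nat (ns ! i)) :: rat)"
        using gt by simp
    qed
    also have "\<dots> = of_nat (part_N ns) * (\<Sum>i<length ns. of_int (ks ! i) ^ 2 / of_nat (ns ! i))"
      by (rule sum_distrib_left[symmetric])
    finally show ?thesis by simp
  qed
  show ?thesis
  proof (rule half_series_eqI)
    fix j :: nat
    have "{ks \<in> {ks :: int list. length ks = length ns \<and> sum_list ks = int k}.
        of_nat (theta_exp ?ab ks) / 2 = 0 + of_nat j / (2 :: rat)} =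
        {ks. length ks = length ?ab \<and> sum_list ks = int k \<and> theta_exp ?ab ks = j}" by auto
    thus "theta_sum ns k (0 + of_nat j / 2) = fps_nth (theta_fps ?ab (int k)) j"
      unfolding theta_sum_def fexp_sum_def theta_fps_def expo by simp
  next
    fix x assume "theta_sum ns k x \<noteq> 0"
    hence "card {ks \<in> {ks :: int list. length ks = length ns \<and> sum_list ks = int k}.
        of_nat (theta_exp ?ab ks) / 2 = x} \<noteq> 0"
      unfolding theta_sum_def fexp_sum_def expo by simp
    hence "{ks \<in> {ks :: int list. length ks = length ns \<and> sum_list ks = int k}.
        of_nat (theta_exp ?ab ks) / 2 = x} \<noteq> {}"
      by (metis card.empty)
    then obtain ks where "of_nat (theta_exp ?ab ks) / 2 = x" by blast
    hence "x = 0 + of_nat (theta_exp ?ab ks) / 2" by simp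
    thus "\<exists>j::nat. x = 0 + of_nat j / 2" by blast
  qed
qed

section \<open>Weights and the specialized exponent\<close>

lemma sum_fun_apply: "(\<Sum>i\<in>A. f i) p = (\<Sum>i\<in>A. f i p :: 'a::comm_monoid_add)"
  by (induction A rule: infinite_finite_induct) auto

lemma fst_wscale [simp]: "fst (z \<bullet>w \<mu>) p = z * fst \<mu> p"
  and snd_wscale [simp]: "fst (snd (z \<bullet>w \<mu>)) = z * fst (snd \<mu>)" "snd (snd (z \<bullet>w \<mu>)) = z * snd (snd \<mu>)"
  by (cases \<mu>; simp)+

lemma weight_eqI:
  "(\<And>p. fst \<mu> p = fst \<nu> p) \<Longrightarrow> fst (snd \<mu>) = fst (snd \<nu>) \<Longrightarrow> snd (snd \<mu>) = snd (snd \<nu>) \<Longrightarrow> \<mu> = (\<nu> :: weight)"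
  by (auto simp: prod_eq_iff fun_eq_iff)

lemma sum_fin_simple_roots:
  assumes "n \<ge> 1"
  shows "fst (\<Sum>i=1..n-1. c i \<bullet>w fin_simple_root i) p =
     (if p \<in> {1..n} then (if p < n then c p else 0) - (if 1 < p then c (p - 1) else 0) else 0)"
    and "snd (\<Sum>i=1..n-1. c i \<bullet>w fin_simple_root i) = 0"
proof -
  have "fst (\<Sum>i=1..n-1. c i \<bullet>w fin_simple_root i) p =
      (\<Sum>i=1..n-1. c i * (of_bool (p = i) - of_bool (p = i + 1)))"
    by (simp add: fst_sum sum_fun_apply fin_simple_root_def)
  also have "\<dots> = (\<Sum>i=1..n-1. if i = p then c i else 0) - (\<Sum>i=1..n-1. if i = p - 1 \<and> p \<ge> 1 then c i else 0)"
    unfolding sum_subtractf[symmetric] by (intro sum.cong refl) auto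
  also have "(\<Sum>i=1..n-1. if i = p - 1 \<and> p \<ge> 1 then c i else 0) =
      (if p \<ge> 1 then \<Sum>i=1..n-1. if i = p - 1 then c i else 0 else 0)" by auto
  finally show "fst (\<Sum>i=1..n-1. c i \<bullet>w fin_simple_root i) p =
     (if p \<in> {1..n} then (if p < n then c p else 0) - (if 1 < p then c (p - 1) else 0) else 0)"
    using assms by (auto simp: sum.delta)
  show "snd (\<Sum>i=1..n-1. c i \<bullet>w fin_simple_root i) = 0"
    by (simp add: snd_sum prod_eq_iff fst_sum fin_simple_root_def)
qed

lemmas snd_sum_fin_simple_roots [simp] = sum_fin_simple_roots(2)[unfolded One_nat_def]

lemma fst_highest_root:
  assumes "n \<ge> 2"
  shows "fst (highest_root n) p = of_bool (p = 1) - of_bool (p = n)" and "snd (highest_root n) = 0"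
proof -
  have "1 \<bullet>w \<mu> = \<mu>" for \<mu> by (rule weight_eqI) auto
  hence "highest_root n = (\<Sum>i=1..n-1. 1 \<bullet>w fin_simple_root i)" by (simp add: highest_root_def)
  thus "fst (highest_root n) p = of_bool (p = 1) - of_bool (p = n)" "snd (highest_root n) = 0"
    using sum_fin_simple_roots[of n "\<lambda>_. 1"] assms by auto
qed

text \<open>The simple root of index 0 contributes -\<epsilon>_1 + \<epsilon>_n, so the coordinates
  are cyclic differences of c. The index p = n wraps around to c 0 through
  \<open>p mod n\<close>.\<close>

lemma sum_simple_roots:
  assumes n: "n \<ge> 2"
  shows "fst (\<Sum>i<n. c i \<bullet>w simple_root n i) p = (if p \<in> {1..n} then c (p mod n) - c (p - 1) else 0)"
    and "fst (snd (\<Sum>i<n. c i \<bullet>w simple_root n i)) = 0"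
    and "snd (snd (\<Sum>i<n. c i \<bullet>w simple_root n i)) = c 0"
proof -
  have "{..<n} = insert 0 {1..n-1}" using n by auto
  hence "(\<Sum>i<n. c i \<bullet>w simple_root n i) = c 0 \<bullet>w (w\<delta> - highest_root n) + (\<Sum>i=1..n-1. c i \<bullet>w fin_simple_root i)"
    by (simp add: simple_root_def)
  moreover have "p mod n = (if p = n then 0 else p)" if "p \<le> n" for p using that by auto
  ultimately show "fst (\<Sum>i<n. c i \<bullet>w simple_root n i) p = (if p \<in> {1..n} then c (p mod n) - c (p - 1) else 0)"
    "fst (snd (\<Sum>i<n. c i \<bullet>w simple_root n i)) = 0"
    "snd (snd (\<Sum>i<n. c i \<bullet>w simple_root n i)) = c 0"
    using n sum_fin_simple_roots[of n c] fst_highest_root[OF n] by (auto simp: w\<delta>_def)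
qed

text \<open>Only the simple root of index 0 involves \<delta>, which gives c 0 = b. The cyclic
  differences then determine the other coefficients as partial sums, and the closing condition at p
  = n is that the coordinates sum to 0.\<close>

lemma root_coeffs_eq:
  assumes n: "n \<ge> 2" and supp: "\<And>p. p \<notin> {1..n} \<Longrightarrow> x p = 0" and sum0: "(\<Sum>p=1..n. x p) = 0"
  shows "root_coeffs n (x, a, b) = (\<lambda>i. if i < n then b + (\<Sum>p=1..i. x p) else 0)"
proof -
  let ?c = "\<lambda>i. if i < n then b + (\<Sum>p=1..i. x p) else 0"
  have iff: "(x, a, b) = fst (snd (x, a, b)) \<bullet>w w\<Lambda>0 + (\<Sum>i<n. c i \<bullet>w simple_root n i) \<longleftrightarrow>
      b = c 0 \<and> (\<forall>p\<in>{1..n}. x p = c (p mod n) - c (p - 1))" (is "?L \<longleftrightarrow> ?R") for c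
  proof
    assume ?L
    hence "fst (x, a, b) p = fst (fst (snd (x, a, b)) \<bullet>w w\<Lambda>0 + (\<Sum>i<n. c i \<bullet>w simple_root n i)) p"
      "snd (snd (x, a, b)) = snd (snd (fst (snd (x, a, b)) \<bullet>w w\<Lambda>0 + (\<Sum>i<n. c i \<bullet>w simple_root n i)))" for p
      by (simp_all only: \<open>?L\<close>[symmetric])
    thus ?R by (simp add: sum_simple_roots[OF n] w\<Lambda>0_def)
  next
    assume ?R
    thus ?L by (intro weight_eqI) (auto simp: sum_simple_roots[OF n] w\<Lambda>0_def supp)
  qed
  have step: "x p = ?c (p mod n) - ?c (p - 1)" if p: "p \<in> {1..n}" for p
  proof -
    have "{1..p} = insert p {1..p-1}" "p \<notin> {1..p-1}" using p by auto
    hence xp: "(\<Sum>q=1..p. x q) = x p + (\<Sum>q=1..p-1. x q)" by (metis sum.insert finite_atLeastAtMost)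
    show ?thesis
    proof (cases "p = n")
      case True
      thus ?thesis using xp sum0 n by simp
    next
      case False
      hence "p mod n = p" "p < n" "p - 1 < n" using p by auto
      thus ?thesis using xp by simp
    qed
  qed
  show ?thesis unfolding root_coeffs_def
  proof (rule the_equality)
    show "(\<forall>i\<ge>n. ?c i = 0) \<and> (x, a, b) = fst (snd (x, a, b)) \<bullet>w w\<Lambda>0 + (\<Sum>i<n. ?c i \<bullet>w simple_root n i)"
      unfolding iff using step n by simp
  next
    fix c assume "(\<forall>i\<ge>n. c i = 0) \<and> (x, a, b) = fst (snd (x, a, b)) \<bullet>w w\<Lambda>0 + (\<Sum>i<n. c i \<bullet>w simple_root n i)"
    hence c: "\<And>i. i \<ge> n \<Longrightarrow> c i = 0" "b = c 0" "\<And>p. p \<in> {1..n} \<Longrightarrow> x p = c (p mod n) - c (p - 1)"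
      unfolding iff by auto
    have "c i = b + (\<Sum>p=1..i. x p)" if "i < n" for i
      using that
    proof (induction i)
      case (Suc i)
      thus ?case using c(3)[of "Suc i"] by simp
    qed (simp add: c)
    thus "c = ?c" using c(1) by fastforce
  qed
qed

text \<open>Summation by parts: if the s i are the differences of a sequence h, up to a
  correction of s 0, then only the pairing of x with h survives.\<close>

lemma spec_exponent_eq:
  assumes n: "n \<ge> 2" and supp: "\<And>p. p \<notin> {1..n} \<Longrightarrow> x p = 0" and sum0: "(\<Sum>p=1..n. x p) = 0"
    and s0: "s 0 = N + h n - h 1" and s: "\<And>i. 0 < i \<Longrightarrow> i < n \<Longrightarrow> s i = h i - h (Suc i)"
  shows "spec_exponent n s v (x, a, b) = a * v - b * N - (\<Sum>p=1..n. h p * x p)"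
proof -
  define c where "c i = b + (\<Sum>p=1..i. x p)" for i
  have cn: "c n = b" "c 0 = b" using sum0 by (simp_all add: c_def)
  have "(\<Sum>i<n. root_coeffs n (x, a, b) i * s i) = (\<Sum>i<n. c i * s i)"
  proof (intro sum.cong refl)
    fix i assume "i \<in> {..<n}"
    moreover have "root_coeffs n (x, a, b) = (\<lambda>i. if i < n then b + (\<Sum>p=1..i. x p) else 0)"
      by (rule root_coeffs_eq) (use n supp sum0 in auto)
    ultimately show "root_coeffs n (x, a, b) i * s i = c i * s i" by (simp add: c_def)
  qed
  \<comment> \<open>The term of index 0 is completed to a difference with the arbitrary value h 0,
    which cancels after telescoping.\<close>
  also have "\<dots> = c 0 * (s 0 - (h 0 - h 1)) + (\<Sum>i<n. c i * (h i - h (Suc i)))"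
  proof -
    have "{..<n} = insert 0 {1..<n}" using n by auto
    moreover have "(\<Sum>i\<in>{1..<n}. c i * s i) = (\<Sum>i\<in>{1..<n}. c i * (h i - h (Suc i)))"
      by (intro sum.cong refl) (simp add: s)
    ultimately show ?thesis by (simp add: algebra_simps)
  qed
  also have "(\<Sum>i<m. c i * (h i - h (Suc i))) = c 0 * h 0 - c m * h m + (\<Sum>p=1..m. h p * x p)" for m
    by (induction m) (simp_all add: c_def algebra_simps)
  finally show ?thesis
    by (simp add: spec_exponent_def cn s0 algebra_simps)
qed

section \<open>Fundamental weights and cosets of the root lattice\<close>

lemma weight_eval_coroot:
  assumes "j < n" "n \<ge> 2"
  shows "weight_eval n (x, a, b) (coroot n j) =
    (if j = 0 then of_rat a - (of_rat (x 1) - of_rat (x n)) else of_rat (x j) - of_rat (x (j + 1)))"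
proof -
  have eq: "(\<Sum>i=1..n. of_rat (x i) * (of_bool (i = u) - of_bool (i = w))) = of_rat (x u) - (of_rat (x w) :: complex)"
    if "u \<in> {1..n}" "w \<in> {1..n}" for u w
  proof -
    have "(\<Sum>i=1..n. of_rat (x i) * (of_bool (i = u) - of_bool (i = w))) =
        (\<Sum>i=1..n. if i = u then of_rat (x i) else 0) - (\<Sum>i=1..n. if i = w then of_rat (x i) else (0::complex))"
      unfolding sum_subtractf[symmetric] by (intro sum.cong refl) auto
    thus ?thesis using that by (simp add: sum.delta)
  qed
  show ?thesis
  proof (cases "j = 0")
    case True
    have "coroot n j = ((\<lambda>m i j. if m = 0 \<and> i = j then of_bool (i = n) - of_bool (i = 1) else 0), 1, 0)"
      using True by (auto simp: coroot_def aff_c_def diag_elt_def fun_eq_iff)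
    thus ?thesis using eq[of n 1] assms True by simp
  next
    case False
    thus ?thesis using eq[of j "j + 1"] assms by (simp add: coroot_def diag_elt_def)
  qed
qed

definition fund_coord :: "nat \<Rightarrow> nat \<Rightarrow> nat \<Rightarrow> rat" where
  "fund_coord n k p = (if p \<in> {1..n} then of_bool (p \<le> k) - of_nat k / of_nat n else 0)"

text \<open>For uniqueness: the coroots of index j > 0 fix the coordinates up to a common shift,
  which the vanishing of their sum excludes. The coroot of index 0 then fixes the level, and the
  value at d fixes the coefficient of \<delta>.\<close>

lemma fund_weight_eq:
  assumes n: "n \<ge> 2" and k: "k < n"
  shows "fund_weight n k = (fund_coord n k, 1, 0)"
  unfolding fund_weight_def
proof (rule the_equality)
  let ?P = "\<lambda>\<Lambda>. \<Lambda> \<in> weights n \<and> (\<forall>j<n. weight_eval n \<Lambda> (coroot n j) = of_bool (j = k)) \<and>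
    weight_eval n \<Lambda> aff_d = 0"
  have sumk: "(\<Sum>p=1..n. fund_coord n k p) = 0"
  proof -
    have "(\<Sum>p=1..n. fund_coord n k p) = (\<Sum>p=1..n. of_bool (p \<le> k)) - (\<Sum>p=1..n. of_nat k / of_nat n)"
      unfolding sum_subtractf[symmetric] by (intro sum.cong refl) (simp add: fund_coord_def)
    moreover have "(\<Sum>p=1..n. of_bool (p \<le> k)) = (of_nat k :: rat)"
    proof -
      have "{1..n} \<inter> {p. p \<le> k} = {1..k}" using k by auto
      thus ?thesis by (simp add: sum.If_cases of_bool_def)
    qed
    ultimately show ?thesis using n by simp
  qed
  have d: "weight_eval n (x, a, b) aff_d = of_rat b" for x a b by (simp add: aff_d_def)
  show "?P (fund_coord n k, 1, 0)"
  proof (intro conjI allI impI)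
    show "(fund_coord n k, 1, 0) \<in> weights n" using sumk by (auto simp: weights_def fund_coord_def)
    fix j assume j: "j < n"
    have "(of_rat (fund_coord n k j) - of_rat (fund_coord n k (j + 1)) :: complex) =
        of_rat (fund_coord n k j - fund_coord n k (j + 1))" by (simp add: of_rat_diff)
    moreover have "(of_rat (fund_coord n k 1) - of_rat (fund_coord n k n) :: complex) =
        of_rat (fund_coord n k 1 - fund_coord n k n)" by (simp add: of_rat_diff)
    ultimately show "weight_eval n (fund_coord n k, 1, 0) (coroot n j) = of_bool (j = k)"
      unfolding weight_eval_coroot[OF j n] using j k n by (auto simp: fund_coord_def of_bool_def)
  qed (simp add: d)
  fix \<Lambda> assume P: "?P \<Lambda>"
  obtain x a b where \<Lambda>: "\<Lambda> = (x, a, b)" by (cases \<Lambda>)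
  have b: "b = 0" using P by (simp add: \<Lambda> d)
  have supp: "x p = 0" if "p \<notin> {1..n}" for p using P that unfolding \<Lambda> weights_def by blast
  have sumx: "(\<Sum>p=1..n. x p) = 0" using P by (simp add: \<Lambda> weights_def)
  have ev: "weight_eval n (x, a, b) (coroot n j) = of_bool (j = k)" if "j < n" for j
    using P that by (simp add: \<Lambda>)
  have step: "x j - x (j + 1) = of_bool (j = k)" if "0 < j" "j < n" for j
  proof -
    have "of_rat (x j - x (j + 1)) = (of_rat (of_bool (j = k)) :: complex)"
      using ev[OF that(2)] weight_eval_coroot[OF that(2) n, of x a b] that by (simp add: of_rat_diff)
    thus ?thesis by (simp only: of_rat_eq_iff)
  qed
  have step0: "a - (x 1 - x n) = of_bool (0 = k)"
  proof -
    have "of_rat (a - (x 1 - x n)) = (of_rat (of_bool (0 = k)) :: complex)"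
      using ev[of 0] weight_eval_coroot[of 0 n x a b] n by (simp add: of_rat_diff)
    thus ?thesis by (simp only: of_rat_eq_iff)
  qed
  define t where "t = x 1 - fund_coord n k 1"
  have diff: "x p - fund_coord n k p = t" if "p \<in> {1..n}" for p
  proof -
    have "Suc m \<le> n \<Longrightarrow> x (Suc m) - fund_coord n k (Suc m) = t" for m
    proof (induction m)
      case (Suc m)
      thus ?case using step[of "Suc m"] by (auto simp: fund_coord_def of_bool_def split: if_splits)
    qed (simp add: t_def)
    from this[of "p - 1"] that show ?thesis by auto
  qed
  have "(\<Sum>p=1..n. x p - fund_coord n k p) = (\<Sum>p=1..n. t)"
    by (rule sum.cong[OF refl diff])
  hence "of_nat n * t = 0" using sumk sumx by (simp add: sum_subtractf)
  hence t0: "t = 0" using n by simp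
  have x: "x = fund_coord n k"
  proof
    fix p show "x p = fund_coord n k p"
      using diff[of p] supp[of p] t0 by (cases "p \<in> {1..n}") (auto simp: fund_coord_def)
  qed
  have "fund_coord n k 1 - fund_coord n k n = of_bool (0 < k)"
    using n k by (cases k) (simp_all add: fund_coord_def)
  hence "a = 1" using step0 by (cases "k = 0") (simp_all add: x)
  thus "\<Lambda> = (fund_coord n k, 1, 0)" by (simp add: \<Lambda> x b)
qed

definition coset_coord :: "nat \<Rightarrow> nat \<Rightarrow> int list \<Rightarrow> nat \<Rightarrow> rat" where
  "coset_coord n k ms p = (if p \<in> {1..n} then of_int (ms ! (p - 1)) - of_nat k / of_nat n else 0)"

lemma sum_shift_1: "(\<Sum>p=1..n. f p) = (\<Sum>i<n. f (Suc i))" for f :: "nat \<Rightarrow> 'a::comm_monoid_add"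
  using sum.atLeast_Suc_atMost_Suc_shift[of f 0 "n - 1"]
  by (cases n) (simp_all add: atLeast0AtMost lessThan_Suc_atMost)

text \<open>The fundamental weight itself belongs to the m with k ones followed by zeros. A root
  lattice element changes m by the successive differences of its root coordinates, and conversely
  these coordinates are the partial sums of the change.\<close>

lemma root_lattice_coset:
  assumes n: "n \<ge> 2" and k: "k < n"
  shows "{\<beta> + wbar (fund_weight n k) | \<beta>. \<beta> \<in> root_lattice n} =
    (\<lambda>ms. (coset_coord n k ms, 0, 0)) ` {ms. length ms = n \<and> sum_list ms = int k}" (is "?A = ?B")
proof (intro equalityI subsetI)
  have sl: "sum_list ms = (\<Sum>i<length ms. ms ! i)" for ms :: "int list"
    by (simp add: sum_list_sum_nth atLeast0LessThan)
  have bk: "(\<Sum>i<n. of_bool (i < k)) = int k"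
  proof -
    have "{..<n} \<inter> {i. i < k} = {..<k}" using k by auto
    thus ?thesis by (simp add: sum.If_cases of_bool_def)
  qed
  {
    fix \<gamma> assume "\<gamma> \<in> ?A"
    then obtain \<beta> where "\<gamma> = \<beta> + wbar (fund_weight n k)" "\<beta> \<in> root_lattice n"
      unfolding mem_Collect_eq by (elim exE conjE)
    moreover from this(2) obtain c :: "nat \<Rightarrow> int" where "\<beta> = (\<Sum>i=1..n-1. of_int (c i) \<bullet>w fin_simple_root i)"
      unfolding root_lattice_def mem_Collect_eq by (elim exE conjE)
    ultimately have \<gamma>: "\<gamma> = (\<Sum>i=1..n-1. of_int (c i) \<bullet>w fin_simple_root i) + (fund_coord n k, 0, 0)"
      by (simp only: fund_weight_eq[OF n k] wbar.simps)
    \<comment> \<open>Extending c by 0 to the indices 0 and n makes the sum of differences telescope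
      to 0.\<close>
    define C where "C i = (if 0 < i \<and> i < n then c i else 0)" for i
    define ms where "ms = map (\<lambda>i. C (Suc i) - C i + of_bool (i < k)) [0..<n]"
    have "(\<Sum>i<n. C (Suc i) - C i) = 0"
      unfolding sum_lessThan_telescope by (simp add: C_def)
    hence "sum_list ms = int k" by (simp add: sl ms_def sum.distrib bk)
    moreover have "\<gamma> = (coset_coord n k ms, 0, 0)"
    proof (rule weight_eqI)
      fix p
      have "fst (\<Sum>i=1..n-1. of_int (c i) \<bullet>w fin_simple_root i) p =
          (if p \<in> {1..n} then of_int (C p) - of_int (C (p - 1)) else (0 :: rat))"
        using n by (subst sum_fin_simple_roots(1)) (auto simp: C_def)
      moreover have "ms ! (p - 1) = C p - C (p - 1) + of_bool (p \<le> k)" if "p \<in> {1..n}"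
      proof -
        have "p - 1 < n" "Suc (p - 1) = p" "p - 1 < k \<longleftrightarrow> p \<le> k" using that by auto
        thus ?thesis by (simp add: ms_def)
      qed
      ultimately show "fst \<gamma> p = fst (coset_coord n k ms, 0, 0) p"
        by (simp add: \<gamma> fund_coord_def coset_coord_def)
    qed (use n in \<open>simp_all add: \<gamma>\<close>)
    moreover have "length ms = n" by (simp add: ms_def)
    ultimately show "\<gamma> \<in> ?B" by (intro image_eqI CollectI conjI)
  }
  {
    fix \<gamma> assume "\<gamma> \<in> ?B"
    then obtain ms where ms: "length ms = n" "sum_list ms = int k" and \<gamma>: "\<gamma> = (coset_coord n k ms, 0, 0)" by auto
    define c where "c i = (\<Sum>j<i. ms ! j - of_bool (j < k))" for i
    have n1: "n \<ge> 1" using n by simp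
    have cn: "c n = 0" "c 0 = 0" using ms by (simp_all add: c_def sl sum_subtractf bk)
    have cS: "c (Suc i) - c i = ms ! i - of_bool (i < k)" for i by (simp add: c_def)
    have "\<gamma> = (\<Sum>i=1..n-1. of_int (c i) \<bullet>w fin_simple_root i) + wbar (fund_weight n k)"
    proof (rule weight_eqI)
      fix p
      have C: "(if p < n then of_int (c p) else 0) - (if 1 < p then of_int (c (p - 1)) else 0) =
         (of_int (ms ! (p - 1)) - of_bool (p \<le> k) :: rat)" if p: "p \<in> {1..n}"
      proof -
        have "(if p < n then of_int (c p) else 0) = (of_int (c p) :: rat)" using p cn by (cases "p = n") auto
        moreover have "(if 1 < p then of_int (c (p - 1)) else 0) = (of_int (c (p - 1)) :: rat)"
          using p cn by (cases "p = 1") auto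
        moreover have "of_int (c p) - of_int (c (p - 1)) = (of_int (c (Suc (p - 1)) - c (p - 1)) :: rat)"
          using p by simp
        moreover have "p - 1 < k \<longleftrightarrow> p \<le> k" using p by auto
        ultimately show ?thesis by (simp only: cS) simp
      qed
      have "fst (\<Sum>i=1..n-1. of_int (c i) \<bullet>w fin_simple_root i) p =
          (if p \<in> {1..n} then of_int (ms ! (p - 1)) - of_bool (p \<le> k) else (0 :: rat))"
        unfolding sum_fin_simple_roots(1)[OF n1] by (intro if_cong refl C)
      thus "fst \<gamma> p = fst ((\<Sum>i=1..n-1. of_int (c i) \<bullet>w fin_simple_root i) + wbar (fund_weight n k)) p"
        by (simp add: \<gamma> fund_weight_eq[OF n k] fund_coord_def coset_coord_def)
    qed (use n in \<open>simp_all add: \<gamma> fund_weight_eq[OF n k]\<close>)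
    moreover have "(\<Sum>i=1..n-1. of_int (c i) \<bullet>w fin_simple_root i) \<in> root_lattice n"
      unfolding root_lattice_def mem_Collect_eq by (intro exI[of _ c] conjI TrueI refl)
    ultimately show "\<gamma> \<in> ?A" unfolding mem_Collect_eq by (intro exI conjI)
  }
qed

lemma coset_coord_inj:
  assumes "coset_coord n k ms = coset_coord n k ms'" "length ms = n" "length ms' = n"
  shows "ms = ms'"
proof (rule nth_equalityI)
  fix i assume "i < length ms"
  thus "ms ! i = ms' ! i" using fun_cong[OF assms(1), of "Suc i"] assms(2,3) by (simp add: coset_coord_def)
qed (use assms in simp)

lemma coset_coord_sum:
  assumes "length ms = n" "sum_list ms = int k" "n \<ge> 1"
  shows "(\<Sum>p=1..n. coset_coord n k ms p) = 0"
proof -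
  have "(\<Sum>p=1..n. coset_coord n k ms p) = (\<Sum>i<n. of_int (ms ! i)) - (\<Sum>i<n. of_nat k / of_nat n)"
    unfolding sum_shift_1 sum_subtractf[symmetric] by (intro sum.cong refl) (simp add: coset_coord_def)
  also have "(\<Sum>i<n. of_int (ms ! i)) = (of_int (sum_list ms) :: rat)"
    using assms(1) by (simp add: sum_list_sum_nth atLeast0LessThan)
  finally show ?thesis using assms by simp
qed

section \<open>Imaginary root multiplicities\<close>

lemma vector_space_aff: "vector_space aff_scale"
proof
  fix a b :: complex and x y :: aff
  obtain x1 x2 x3 where x: "x = (x1, x2, x3)" by (cases x)
  obtain y1 y2 y3 where y: "y = (y1, y2, y3)" by (cases y)
  show "aff_scale a (x + y) = aff_scale a x + aff_scale a y"
    "aff_scale (a + b) x = aff_scale a x + aff_scale b x"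
    "aff_scale a (aff_scale b x) = aff_scale (a * b) x"
    "aff_scale 1 x = x"
    by (auto simp: x y fun_eq_iff algebra_simps)
qed

definition loop_diag :: "int \<Rightarrow> (nat \<Rightarrow> complex) \<Rightarrow> aff" where
  "loop_diag r h = ((\<lambda>m i j. if m = r \<and> i = j then h i else 0), 0, 0)"

lemma bracket_diag_elt:
  assumes h: "\<And>i. h i \<noteq> 0 \<Longrightarrow> i \<in> {1..n}" and x: "\<And>m i j. x m i j \<noteq> 0 \<Longrightarrow> i \<in> {1..n} \<and> j \<in> {1..n}"
  shows "fst (aff_bracket n (loop_diag 0 h) (x, a, b)) m i j = (h i - h j) * x m i j"
    and "fst (snd (aff_bracket n (loop_diag 0 h) (x, a, b))) = 0"
proof -
  let ?D = "\<lambda>m i j. if m = (0::int) \<and> i = j then h i else (0::complex)"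
  have sup: "{p. ?D p \<noteq> 0} \<subseteq> {0}" by (auto simp: fun_eq_iff)
  have D: "?D 0 = 0" if "{p. ?D p \<noteq> 0} \<noteq> {0}" using that sup by auto
  \<comment> \<open>The support of the diagonal element is {0}, or empty if h = 0. The condition
    \<open>f 0 0 = 0\<close> makes both cases agree.\<close>
  have sum1: "(\<Sum>p | ?D p \<noteq> 0. f p (?D p)) = f 0 (?D 0)" if "f 0 0 = 0" for f :: "int \<Rightarrow> (nat \<Rightarrow> nat \<Rightarrow> complex) \<Rightarrow> complex"
  proof (cases "{p. ?D p \<noteq> 0} = {0}")
    case False
    hence "{p. ?D p \<noteq> 0} = {}" using sup by blast
    thus ?thesis using D[OF False] that by (simp only: sum.empty)
  qed (simp only: sum.insert sum.empty finite.emptyI empty_iff, simp)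
  have m1: "mat_mult n (?D 0) y i j = h i * y i j" if "\<And>k. y k j \<noteq> 0 \<Longrightarrow> k \<in> {1..n}" for y i j
  proof -
    have "mat_mult n (?D 0) y i j = (\<Sum>k=1..n. if k = i then h i * y i j else 0)"
      unfolding mat_mult_def by (intro sum.cong) auto
    thus ?thesis using that[of i] by (auto simp: sum.delta)
  qed
  have m2: "mat_mult n y (?D 0) i j = y i j * h j" for y i j
  proof -
    have "mat_mult n y (?D 0) i j = (\<Sum>k=1..n. if k = j then y i j * h j else 0)"
      unfolding mat_mult_def by (intro sum.cong) auto
    thus ?thesis using h[of j] by (auto simp: sum.delta)
  qed
  have "fst (aff_bracket n (loop_diag 0 h) (x, a, b)) m i j =
      (\<Sum>p | ?D p \<noteq> 0. mat_mult n (?D p) (x (m - p)) i j - mat_mult n (x (m - p)) (?D p) i j)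
        - b * of_int m * ?D m i j"
    by (simp add: loop_diag_def)
  also have "(\<Sum>p | ?D p \<noteq> 0. mat_mult n (?D p) (x (m - p)) i j - mat_mult n (x (m - p)) (?D p) i j) =
      mat_mult n (?D 0) (x (m - 0)) i j - mat_mult n (x (m - 0)) (?D 0) i j"
    by (rule sum1[of "\<lambda>p A. mat_mult n A (x (m - p)) i j - mat_mult n (x (m - p)) A i j"])
      (simp add: mat_mult_def)
  also have "\<dots> = (h i - h j) * x m i j"
    using m1[of "x m" j i] m2[of "x m" i j] x by (simp add: algebra_simps)
  finally show "fst (aff_bracket n (loop_diag 0 h) (x, a, b)) m i j = (h i - h j) * x m i j" by simp
  have "fst (snd (aff_bracket n (loop_diag 0 h) (x, a, b))) =
     (\<Sum>p | ?D p \<noteq> 0. of_int p * mat_trace n (mat_mult n (?D p) (x (- p))))"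
    by (simp add: loop_diag_def)
  also have "\<dots> = of_int 0 * mat_trace n (mat_mult n (?D 0) (x (- 0)))"
    by (rule sum1[of "\<lambda>p A. of_int p * mat_trace n (mat_mult n A (x (- p)))"]) simp
  finally show "fst (snd (aff_bracket n (loop_diag 0 h) (x, a, b))) = 0" by simp
qed

lemma cartan_hat_eq:
  "cartan_hat n = {(fst (loop_diag 0 h), a, b) | h (a::complex) (b::complex). (\<forall>i. h i \<noteq> 0 \<longrightarrow> i \<in> {1..n}) \<and> (\<Sum>i=1..n. h i) = 0}"
proof (intro equalityI subsetI)
  fix X assume X: "X \<in> cartan_hat n"
  obtain x a b where Xe: "X = (x, a, b)" by (cases X)
  have "x = fst (loop_diag 0 (\<lambda>i. x 0 i i))"
    using X by (auto simp: Xe cartan_hat_def loop_diag_def fun_eq_iff)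
  moreover have "\<forall>i. x 0 i i \<noteq> 0 \<longrightarrow> i \<in> {1..n}" "(\<Sum>i=1..n. x 0 i i) = 0"
    using X by (auto simp: Xe cartan_hat_def sl_hat_def)
  ultimately show "X \<in> {(fst (loop_diag 0 h), a, b) | h (a::complex) (b::complex). (\<forall>i. h i \<noteq> 0 \<longrightarrow> i \<in> {1..n}) \<and> (\<Sum>i=1..n. h i) = 0}"
    unfolding Xe by blast
next
  fix X assume "X \<in> {(fst (loop_diag 0 h), a, b) | h (a::complex) (b::complex). (\<forall>i. h i \<noteq> 0 \<longrightarrow> i \<in> {1..n}) \<and> (\<Sum>i=1..n. h i) = 0}"
  then obtain h a b where h: "X = (fst (loop_diag 0 h), a, b)" "\<forall>i. h i \<noteq> 0 \<longrightarrow> i \<in> {1..n}" "(\<Sum>i=1..n. h i) = 0" by blast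
  have "finite {m. fst (loop_diag 0 h) m \<noteq> 0}"
    by (rule finite_subset[of _ "{0}"]) (auto simp: loop_diag_def fun_eq_iff)
  moreover have "(\<Sum>i=1..n. fst (loop_diag 0 h) m i i) = 0" for m
    using h(3) by (cases "m = 0") (simp_all add: loop_diag_def)
  moreover have "fst (loop_diag 0 h) m i j \<noteq> 0 \<Longrightarrow> m = 0 \<and> i = j \<and> i \<in> {1..n}" for m i j
    using h(2) by (auto simp: loop_diag_def split: if_splits)
  ultimately show "X \<in> cartan_hat n" unfolding h(1) cartan_hat_def sl_hat_def by blast
qed

text \<open>Eigenvectors of d with eigenvalue r > 0 contain only the power t^r and no component
  along c or d. Commuting with a diagonal matrix that separates i from j kills the entry (i,
  j).\<close>

lemma root_space_imaginary:
  assumes n: "n \<ge> 2" and r: "r > 0"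
  shows "root_space n (of_nat r \<bullet>w w\<delta>) =
    {loop_diag (int r) h | h. (\<forall>i. h i \<noteq> 0 \<longrightarrow> i \<in> {1..n}) \<and> (\<Sum>i=1..n. h i) = 0}"
    (is "?L = ?R")
proof -
  have ev: "weight_eval n (of_nat r \<bullet>w w\<delta>) (x, a, b) = of_nat r * b" for x a b
    by (simp add: w\<delta>_def)
  have split: "aff_bracket n (fst (loop_diag 0 h), c, d) (x, a, b) =
      ((\<lambda>m i j. fst (aff_bracket n (loop_diag 0 h) (x, a, b)) m i j + d * of_int m * x m i j),
       fst (snd (aff_bracket n (loop_diag 0 h) (x, a, b))), 0)" for h c d x a b
    by (simp add: loop_diag_def fun_eq_iff)
  have "X \<in> ?R" if X: "X \<in> ?L" for X
  proof -
    obtain x a b where Xe: "X = (x, a, b)" by (cases X)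
    have sl: "\<And>m i j. x m i j \<noteq> 0 \<Longrightarrow> i \<in> {1..n} \<and> j \<in> {1..n}" "\<And>m. (\<Sum>i=1..n. x m i i) = 0"
      using X by (auto simp: Xe root_space_def sl_hat_def)
    have br: "aff_bracket n (fst (loop_diag 0 h), c, d) (x, a, b) = aff_scale (of_nat r * d) (x, a, b)"
      if "\<forall>i. h i \<noteq> 0 \<longrightarrow> i \<in> {1..n}" "(\<Sum>i=1..n. h i) = 0" for h c d
    proof -
      have "(fst (loop_diag 0 h), c, d) \<in> cartan_hat n" using that unfolding cartan_hat_eq by blast
      hence "aff_bracket n (fst (loop_diag 0 h), c, d) X = aff_scale (weight_eval n (of_nat r \<bullet>w w\<delta>) (fst (loop_diag 0 h), c, d)) X"
        using X by (simp add: root_space_def)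
      thus ?thesis by (simp only: ev Xe)
    qed
    have b1: "fst (aff_bracket n (loop_diag 0 h) (x, a, b)) m i j + d * of_int m * x m i j = of_nat r * d * x m i j"
        "fst (snd (aff_bracket n (loop_diag 0 h) (x, a, b))) = of_nat r * d * a" "0 = of_nat r * d * b"
      if "\<forall>i. h i \<noteq> 0 \<longrightarrow> i \<in> {1..n}" "(\<Sum>i=1..n. h i) = 0" for h d m i j
      using br[OF that, of 0 d] unfolding split by (simp_all add: fun_eq_iff)
    have c0: "fst (aff_bracket n (loop_diag 0 (\<lambda>_. 0)) (x, a, b)) m i j = 0"
      "fst (snd (aff_bracket n (loop_diag 0 (\<lambda>_. 0)) (x, a, b))) = 0" for m i j
    proof -
      have z: "(0::complex) \<noteq> 0 \<Longrightarrow> i \<in> {1..n}" for i :: nat by simp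
      show "fst (aff_bracket n (loop_diag 0 (\<lambda>_. 0)) (x, a, b)) m i j = 0"
        by (subst bracket_diag_elt(1)[OF z sl(1)]) simp_all
      show "fst (snd (aff_bracket n (loop_diag 0 (\<lambda>_. 0)) (x, a, b))) = 0"
        by (rule bracket_diag_elt(2)[OF z sl(1)])
    qed
    have a0: "a = 0" using b1(2)[of "\<lambda>_. 0" 1] c0 r by simp
    have b0: "b = 0" using b1(3)[of "\<lambda>_. 0" 1] r by simp
    have xr: "x m i j = 0" if "m \<noteq> int r" for m i j
    proof -
      have "of_int m * x m i j = of_int (int r) * x m i j" using b1(1)[of "\<lambda>_. 0" m i j 1] c0 by simp
      hence "(of_int m - of_int (int r)) * x m i j = 0" by (simp only: left_diff_distrib diff_self)
      moreover have "of_int m \<noteq> (of_int (int r) :: complex)" using that by (simp only: of_int_eq_iff not_False_eq_True)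
      ultimately show ?thesis by simp
    qed
    have xd: "x m i j = 0" if "i \<noteq> j" for m i j
    proof (rule ccontr)
      assume nz: "x m i j \<noteq> 0"
      hence ij: "i \<in> {1..n}" "j \<in> {1..n}" using sl(1) by blast+
      \<comment> \<open>The trace zero matrix E_ii - E_jj; the bracket with it multiplies the entry
        (i, j) by 2.\<close>
      let ?h = "\<lambda>p. of_bool (p = i) - of_bool (p = j) :: complex"
      have h1: "\<forall>p. ?h p \<noteq> 0 \<longrightarrow> p \<in> {1..n}" using ij by auto
      have h2: "(\<Sum>p=1..n. ?h p) = 0" using ij by (simp add: sum_subtractf of_bool_def sum.delta)
      have "fst (aff_bracket n (loop_diag 0 ?h) (x, a, b)) m i j = (?h i - ?h j) * x m i j"
        by (rule bracket_diag_elt(1)[OF h1[rule_format] sl(1)])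
      moreover have "fst (aff_bracket n (loop_diag 0 ?h) (x, a, b)) m i j = 0"
        using b1(1)[OF h1 h2, of m i j 0] by simp
      ultimately have "(?h i - ?h j) * x m i j = 0" by simp
      thus False using nz that by simp
    qed
    have "X = loop_diag (int r) (\<lambda>i. x (int r) i i)"
    proof -
      have "x m i j = (if m = int r \<and> i = j then x (int r) i i else 0)" for m i j
        using xr[of m i j] xd[of i j m] by (cases "m = int r"; cases "i = j") simp_all
      hence "x = (\<lambda>m i j. if m = int r \<and> i = j then x (int r) i i else 0)" by (intro ext)
      thus ?thesis by (simp only: Xe loop_diag_def a0 b0)
    qed
    moreover have "\<forall>i. x (int r) i i \<noteq> 0 \<longrightarrow> i \<in> {1..n}" using sl(1) by blast
    ultimately show ?thesis using sl(2) by blast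
  qed
  moreover have "X \<in> ?L" if "X \<in> ?R" for X
  proof -
    from that obtain g where g: "X = loop_diag (int r) g" "\<forall>i. g i \<noteq> 0 \<longrightarrow> i \<in> {1..n}" "(\<Sum>i=1..n. g i) = 0" by blast
    define x where "x = fst (loop_diag (int r) g)"
    have Xe: "X = (x, 0, 0)" by (simp add: x_def g loop_diag_def)
    have sup: "x m i j \<noteq> 0 \<Longrightarrow> m = int r \<and> i = j \<and> i \<in> {1..n} \<and> j \<in> {1..n}" for m i j
      using g(2) by (auto simp: x_def loop_diag_def split: if_splits)
    have "finite {m. x m \<noteq> 0}"
      by (rule finite_subset[of _ "{int r}"]) (use sup in \<open>auto simp: fun_eq_iff\<close>)
    moreover have "(\<Sum>i=1..n. x m i i) = 0" for m
      using g(3) by (cases "m = int r") (simp_all add: x_def loop_diag_def)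
    ultimately have "X \<in> sl_hat n" using sup unfolding Xe sl_hat_def by blast
    moreover have "aff_bracket n H X = aff_scale (weight_eval n (of_nat r \<bullet>w w\<delta>) H) X" if "H \<in> cartan_hat n" for H
    proof -
      obtain h c d where h: "H = (fst (loop_diag 0 h), c, d)" "\<forall>i. h i \<noteq> 0 \<longrightarrow> i \<in> {1..n}" "(\<Sum>i=1..n. h i) = 0"
        using \<open>H \<in> cartan_hat n\<close> unfolding cartan_hat_eq by blast
      have hh: "h i \<noteq> 0 \<Longrightarrow> i \<in> {1..n}" for i using h(2) by blast
      have xx: "x m i j \<noteq> 0 \<Longrightarrow> i \<in> {1..n} \<and> j \<in> {1..n}" for m i j using sup[of m i j] by blast
      have bd: "fst (aff_bracket n (loop_diag 0 h) (x, 0, 0)) m i j = (h i - h j) * x m i j"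
        "fst (snd (aff_bracket n (loop_diag 0 h) (x, 0, 0))) = 0" for m i j
        by (rule bracket_diag_elt[OF hh xx]; assumption)+
      have "(h i - h j) * x m i j + d * of_int m * x m i j = of_nat r * d * x m i j" for m i j
        using sup[of m i j] by (cases "x m i j = 0") auto
      thus ?thesis unfolding h(1) Xe split ev bd by (simp add: fun_eq_iff)
    qed
    ultimately show ?thesis by (simp add: root_space_def)
  qed
  ultimately show "?L = ?R" by blast
qed

text \<open>The elements (E_pp - E_nn) t^r with p < n form a basis: the coefficient of the p-th one
  is the diagonal entry p, and the entry n is determined by the trace.\<close>

lemma root_mult_imaginary:
  assumes n: "n \<ge> 2" and r: "r > 0"
  shows "root_mult n (of_nat r \<bullet>w w\<delta>) = n - 1"
proof -
  interpret vector_space aff_scale by (rule vector_space_aff)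
  define E where "E p = loop_diag (int r) (\<lambda>i. of_bool (i = p) - of_bool (i = n))" for p
  have E_at: "fst (E p) (int r) q q = of_bool (q = p) - of_bool (q = n)" for p q
    by (simp add: E_def loop_diag_def)
  have inj: "inj_on E {1..n-1}"
  proof (rule inj_onI)
    fix p q assume pq: "p \<in> {1..n-1}" "q \<in> {1..n-1}" "E p = E q"
    have "fst (E p) (int r) p p = fst (E q) (int r) p p" using pq by simp
    thus "p = q" using pq unfolding E_at by (auto split: if_splits simp: of_bool_def)
  qed
  have lin: "(\<Sum>p=1..n-1. aff_scale (u p) (E p)) =
      loop_diag (int r) (\<lambda>i. \<Sum>p=1..n-1. u p * (of_bool (i = p) - of_bool (i = n)))" for u
  proof -
    have "(\<Sum>p\<in>A. aff_scale (u p) (E p)) = loop_diag (int r) (\<lambda>i. \<Sum>p\<in>A. u p * (of_bool (i = p) - of_bool (i = n)))" if "finite A" for A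
      using that by (induction A) (auto simp: E_def loop_diag_def fun_eq_iff zero_prod_def)
    thus ?thesis by simp
  qed
  have lin_at: "(\<Sum>p=1..n-1. u p * (of_bool (i = p) - of_bool (i = n))) = u i" if "i \<in> {1..n-1}" for u :: "nat \<Rightarrow> complex" and i
  proof -
    have "(\<Sum>p=1..n-1. u p * (of_bool (i = p) - of_bool (i = n))) = (\<Sum>p=1..n-1. if p = i then u i else 0)"
      using that n by (intro sum.cong) auto
    thus ?thesis using that by (simp add: sum.delta)
  qed
  have "dim (root_space n (of_nat r \<bullet>w w\<delta>)) = n - 1"
  proof (rule dim_unique)
    show "E ` {1..n-1} \<subseteq> root_space n (of_nat r \<bullet>w w\<delta>)"
    proof (rule image_subsetI)
      fix p assume p: "p \<in> {1..n-1}"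
      have "(\<Sum>i=1..n. of_bool (i = p) - of_bool (i = n) :: complex) = 0"
        using p n by (auto simp: sum_subtractf of_bool_def sum.delta)
      moreover have "\<forall>i. of_bool (i = p) - of_bool (i = n) \<noteq> (0 :: complex) \<longrightarrow> i \<in> {1..n}" using p by auto
      ultimately show "E p \<in> root_space n (of_nat r \<bullet>w w\<delta>)"
        unfolding root_space_imaginary[OF n r] E_def by blast
    qed
    show "root_space n (of_nat r \<bullet>w w\<delta>) \<subseteq> span (E ` {1..n-1})"
    proof
      fix X assume "X \<in> root_space n (of_nat r \<bullet>w w\<delta>)"
      then obtain h where h: "X = loop_diag (int r) h" "\<forall>i. h i \<noteq> 0 \<longrightarrow> i \<in> {1..n}" "(\<Sum>i=1..n. h i) = 0"
        unfolding root_space_imaginary[OF n r] by blast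
      have hi: "h i = (\<Sum>p=1..n-1. h p * (of_bool (i = p) - of_bool (i = n)))" for i
      proof -
        consider "i \<in> {1..n-1}" | "i = n" | "i \<notin> {1..n}" by fastforce
        thus ?thesis
        proof cases
          case 2
          have "{1..n} = insert n {1..n-1}" using n by auto
          hence "h n = - (\<Sum>p=1..n-1. h p)" using h(3) n by (simp add: eq_neg_iff_add_eq_0)
          also have "\<dots> = (\<Sum>p=1..n-1. h p * (of_bool (i = p) - of_bool (i = n)))"
            unfolding sum_negf[symmetric] using 2 n by (intro sum.cong) auto
          finally show ?thesis using 2 by simp
        next
          case 3
          have "(\<Sum>p=1..n-1. h p * (of_bool (i = p) - of_bool (i = n))) = 0"
            using 3 n by (intro sum.neutral) auto
          moreover have "h i = 0" using 3 h(2) by blast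
          ultimately show ?thesis by simp
        qed (simp only: lin_at)
      qed
      have "X = (\<Sum>p=1..n-1. aff_scale (h p) (E p))"
        unfolding lin h(1) by (rule arg_cong[OF ext[OF hi]])
      also have "\<dots> \<in> span (E ` {1..n-1})" by (intro span_sum span_scale span_base) auto
      finally show "X \<in> span (E ` {1..n-1})" .
    qed
    show "independent (E ` {1..n-1})"
    proof (rule independent_if_scalars_zero)
      fix f X assume f: "(\<Sum>X\<in>E ` {1..n-1}. aff_scale (f X) X) = 0" and "X \<in> E ` {1..n-1}"
      then obtain p where p: "p \<in> {1..n-1}" "X = E p" by blast
      have "loop_diag (int r) (\<lambda>i. \<Sum>q=1..n-1. f (E q) * (of_bool (i = q) - of_bool (i = n))) = 0"
        using f unfolding lin[symmetric] sum.reindex[OF inj] comp_def .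
      hence "fst (loop_diag (int r) (\<lambda>i. \<Sum>q=1..n-1. f (E q) * (of_bool (i = q) - of_bool (i = n)))) (int r) p p = 0"
        by (simp only: fst_zero zero_fun_apply)
      hence "(\<Sum>q=1..n-1. f (E q) * (of_bool (p = q) - of_bool (p = n))) = 0"
        by (simp add: loop_diag_def)
      thus "f X = 0" unfolding lin_at[OF p(1)] using p by simp
    qed auto
    show "card (E ` {1..n-1}) = n - 1" by (subst card_image[OF inj]) simp
  qed
  thus ?thesis by (simp add: root_mult_def)
qed

section \<open>Specialization of the lattice quotient\<close>

text \<open>The sequence \<open>part_s\<close> consists, up to the correction N at index 0, of the cyclic differences
  of this sequence of heights, which in each block is a multiple of the Weyl vector.\<close>

definition principal_heights :: "nat \<Rightarrow> nat \<Rightarrow> rat list" where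
  "principal_heights N a = map (\<lambda>j. of_nat N * (of_nat a - 1 - 2 * of_nat j) / (2 * of_nat a)) [0..<a]"

text \<open>Inside a block of size a the heights fall by N/a. Between blocks of sizes a and b they
  pass from -N(a-1)/(2a) to N(b-1)/(2b), and the difference N((a+b)/(2ab) - 1) accounts for the -1
  in the boundary entries of s.\<close>

lemma part_blocks_differences:
  assumes "ns \<noteq> []" "\<forall>a\<in>set ns. 0 < a"
  shows "\<forall>i<sum_list ns - 1. of_nat N * part_blocks ns ! i =
     concat (map (principal_heights N) ns) ! i - concat (map (principal_heights N) ns) ! Suc i"
  using assms
proof (induction ns rule: part_blocks.induct)
  case (2 a)
  have "of_nat N * (1 / of_nat a) = (of_nat N * (of_nat a - 1 - 2 * of_nat i) / (2 * of_nat a) -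
      of_nat N * (of_nat a - 1 - 2 * of_nat (Suc i)) / (2 * of_nat a) :: rat)" for i
    using 2 by (simp add: field_simps)
  moreover have "i < a \<Longrightarrow> principal_heights N a ! i = of_nat N * (of_nat a - 1 - 2 * of_nat i) / (2 * of_nat a)" for i
    by (simp add: principal_heights_def)
  ultimately show ?case by simp
next
  case (3 a b cs)
  let ?H = "concat (map (principal_heights N) (b # cs))"
  have a: "a > 0" and b: "b > 0" using 3 by auto
  have len: "length (principal_heights N a) = a" for a by (simp add: principal_heights_def)
  show ?case
  proof (intro allI impI)
    fix i assume i: "i < sum_list (a # b # cs) - 1"
    have H: "concat (map (principal_heights N) (a # b # cs)) ! m =
        (if m < a then of_nat N * (of_nat a - 1 - 2 * of_nat m) / (2 * of_nat a) else ?H ! (m - a))" for m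
      by (simp add: nth_append len) (simp add: principal_heights_def)
    have H0: "?H ! 0 = of_nat N * (of_nat b - 1) / (2 * of_nat b)"
      using b by (simp add: nth_append len) (simp add: principal_heights_def)
    consider "Suc i < a" | "Suc i = a" | "a \<le> i" by linarith
    thus "of_nat N * part_blocks (a # b # cs) ! i = concat (map (principal_heights N) (a # b # cs)) ! i -
        concat (map (principal_heights N) (a # b # cs)) ! Suc i"
    proof cases
      case 1
      have "part_blocks (a # b # cs) ! i = 1 / of_nat a"
      proof -
        have "i < a - 1" using 1 by simp
        thus ?thesis by (simp add: nth_append)
      qed
      moreover have "of_nat N * (1 / of_nat a) = (of_nat N * (of_nat a - 1 - 2 * of_nat i) / (2 * of_nat a) -
        of_nat N * (of_nat a - 1 - 2 * of_nat (Suc i)) / (2 * of_nat a) :: rat)"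
        using a by (simp add: field_simps)
      ultimately show ?thesis unfolding H using 1 by simp
    next
      case 2
      have "part_blocks (a # b # cs) ! i = of_nat (a + b) / of_nat (2 * a * b) - 1"
      proof -
        have "i = a - 1" using 2 by simp
        thus ?thesis by (simp add: nth_append)
      qed
      moreover have "of_nat N * (of_nat (a + b) / of_nat (2 * a * b) - 1) =
          (of_nat N * (of_nat a - 1 - 2 * of_nat i) / (2 * of_nat a) - of_nat N * (of_nat b - 1) / (2 * of_nat b) :: rat)"
      proof -
        have id: "z * ((x + y) / (2 * x * y) - 1) = z * (x - 1 - 2 * (x - 1)) / (2 * x) - z * (y - 1) / (2 * y)"
          if "x \<noteq> 0" "y \<noteq> 0" for x y z :: rat using that by (simp add: field_simps)
        have "(of_nat i :: rat) = of_nat a - 1" using 2 by (metis of_nat_Suc add_diff_cancel_left')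
        thus ?thesis using id[of "of_nat a" "of_nat b" "of_nat N"] a b by simp
      qed
      ultimately show ?thesis unfolding H using 2 H0 by simp
    next
      case 3
      have "part_blocks (a # b # cs) ! i = part_blocks (b # cs) ! (i - a)"
      proof -
        have "i - (a - 1) = Suc (i - a)" "\<not> i < a - 1" using 3 a by auto
        thus ?thesis by (simp add: nth_append)
      qed
      moreover have "i - a < sum_list (b # cs) - 1" using i 3 by simp
      hence "of_nat N * part_blocks (b # cs) ! (i - a) = ?H ! (i - a) - ?H ! Suc (i - a)"
        using "3.IH" "3.prems" by simp
      moreover have "Suc i - a = Suc (i - a)" using 3 by simp
      ultimately show ?thesis unfolding H using 3 by simp
    qed
  qed
qed simp

text \<open>The linear coefficient of \<open>fst p * tri m + snd p * tri (m - 1)\<close> is half of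
  \<open>fst p - snd p\<close>, and passing from X to q halves it again, hence the 4. The sign is
  reversed because the specialized exponent contains minus the pairing with the heights.\<close>

lemma map_principal_block:
  assumes "a dvd N" "a > 0"
  shows "map (\<lambda>p. (of_nat (snd p) - of_nat (fst p)) / 4) (principal_block (N div a) a) = principal_heights N a"
proof -
  obtain d where N: "N = a * d" using assms by blast
  have "(of_nat (d * (2 * (a - Suc j) + 1)) - of_nat (d * (2 * j + 1))) / 4 =
      (of_nat N * (of_nat a - 1 - 2 * of_nat j) / (2 * of_nat a) :: rat)" if "j < a" for j
  proof -
    define b where "b = a - Suc j"
    have b: "a = Suc j + b" using that by (simp add: b_def)
    have "(of_nat (Suc j + b) :: rat) \<noteq> 0" by (simp only: of_nat_eq_0_iff)
    thus ?thesis unfolding N b by (simp add: field_simps)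
  qed
  thus ?thesis using assms by (simp add: principal_block_def principal_heights_def N)
qed

section \<open>Coefficients of the lattice quotient\<close>

lemma fps_inverse_prod:
  fixes f :: "'i \<Rightarrow> 'a::field fps"
  shows "inverse (\<Prod>i\<in>A. f i) = (\<Prod>i\<in>A. inverse (f i))"
  by (induction A rule: infinite_finite_induct) (simp_all add: fps_inverse_mult)

lemma fps_prod_nth_0: "fps_nth (\<Prod>i\<in>A. f i) 0 = (\<Prod>i\<in>A. fps_nth (f i) 0 :: 'a::comm_ring_1)"
  by (induction A rule: infinite_finite_induct) simp_all

lemma sum_const_weight: "(\<Sum>i<j::nat. - w\<delta>) = (0, 0, - of_nat j)"
  by (induction j) (auto simp: w\<delta>_def zero_prod_def)

text \<open>The exponent \<Lambda>_0 + \<gamma> - (|\<gamma>|^2 / 2 + j) \<delta>, where \<gamma> is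
  the coset element given by ms and j is the power of e^(-\<delta>) taken from the
  denominator.\<close>

definition theta_weight :: "nat \<Rightarrow> nat \<Rightarrow> int list \<Rightarrow> nat \<Rightarrow> weight" where
  "theta_weight n k ms j = (coset_coord n k ms, 1, - (\<Sum>p=1..n. (coset_coord n k ms p)\<^sup>2) / 2 - of_nat j)"

text \<open>The \<epsilon>-coordinates of an exponent determine \<gamma>, and then its
  \<delta>-coordinate determines j. So each coefficient of the product of the two series has at most
  one term.\<close>

lemma lattice_quotient_eq:
  assumes n: "n \<ge> 2" and k: "k < n"
  shows "length ms = n \<Longrightarrow> sum_list ms = int k \<Longrightarrow>
      lattice_quotient n k (theta_weight n k ms j) = fps_nth (inverse (euler_phi 1 ^ (n - 1))) j"
    and "lattice_quotient n k \<mu> \<noteq> 0 \<Longrightarrow>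
      \<exists>ms j. length ms = n \<and> sum_list ms = int k \<and> \<mu> = theta_weight n k ms j"
proof -
  let ?M = "{ms. length ms = n \<and> sum_list ms = int k}"
  define P where "P = inverse (euler_phi 1 ^ (n - 1) :: complex fps)"
  define f where "f = fexp_sum ((\<lambda>ms. (coset_coord n k ms, 0, 0)) ` ?M)
       (\<lambda>\<gamma>. w\<Lambda>0 + \<gamma> - (wform n \<gamma> \<gamma> / 2) \<bullet>w w\<delta>)"
  define g where "g = fps_at (- w\<delta>) P"
  have rm: "root_mult n (of_nat (Suc j) \<bullet>w w\<delta>) = n - 1" for j
    by (rule root_mult_imaginary[OF n]) simp
  have L: "lattice_quotient n k = f \<star> g"
    unfolding lattice_quotient_def root_lattice_coset[OF n k] rm f_def g_def P_def prodinf_power_eq_euler_phi ..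
  have u: "w\<Lambda>0 + (x, 0, 0) - (wform n (x, 0, 0) (x, 0, 0) / 2) \<bullet>w w\<delta> = (x, 1, - (\<Sum>p=1..n. (x p)\<^sup>2) / 2)" for x
    by (rule weight_eqI) (simp_all add: w\<Lambda>0_def w\<delta>_def power2_eq_square)
  have f1: "f (theta_weight n k ms 0) = 1" if ms: "ms \<in> ?M" for ms
  proof -
    have "{\<gamma> \<in> (\<lambda>ms. (coset_coord n k ms, 0, 0)) ` ?M.
        w\<Lambda>0 + \<gamma> - (wform n \<gamma> \<gamma> / 2) \<bullet>w w\<delta> = theta_weight n k ms 0} = {(coset_coord n k ms, 0, 0)}"
      (is "?S = _")
    proof (intro equalityI subsetI)
      fix \<gamma> assume "\<gamma> \<in> ?S"
      then obtain ms' where "\<gamma> = (coset_coord n k ms', 0, 0)"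
        "w\<Lambda>0 + \<gamma> - (wform n \<gamma> \<gamma> / 2) \<bullet>w w\<delta> = theta_weight n k ms 0" by blast
      thus "\<gamma> \<in> {(coset_coord n k ms, 0, 0)}" by (simp only: u theta_weight_def prod.inject singleton_iff simp_thms)
    next
      fix \<gamma> :: weight assume "\<gamma> \<in> {(coset_coord n k ms, 0, 0)}"
      hence \<gamma>: "\<gamma> = (coset_coord n k ms, 0, 0)" by simp
      have "w\<Lambda>0 + \<gamma> - (wform n \<gamma> \<gamma> / 2) \<bullet>w w\<delta> = theta_weight n k ms 0"
        unfolding \<gamma> u theta_weight_def by simp
      thus "\<gamma> \<in> ?S" using ms \<gamma> by blast
    qed
    thus ?thesis by (simp only: f_def fexp_sum_def) simp
  qed
  have f0: "\<exists>ms\<in>?M. y = theta_weight n k ms 0" if "f y \<noteq> 0" for y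
  proof -
    have "card {\<gamma> \<in> (\<lambda>ms. (coset_coord n k ms, 0, 0)) ` ?M.
        w\<Lambda>0 + \<gamma> - (wform n \<gamma> \<gamma> / 2) \<bullet>w w\<delta> = y} \<noteq> 0"
      using that unfolding f_def fexp_sum_def by simp
    hence "{\<gamma> \<in> (\<lambda>ms. (coset_coord n k ms, 0, 0)) ` ?M.
        w\<Lambda>0 + \<gamma> - (wform n \<gamma> \<gamma> / 2) \<bullet>w w\<delta> = y} \<noteq> {}" by (metis card.empty)
    then obtain ms where ms: "ms \<in> ?M" and
      "w\<Lambda>0 + (coset_coord n k ms, 0, 0) - (wform n (coset_coord n k ms, 0, 0) (coset_coord n k ms, 0, 0) / 2) \<bullet>w w\<delta> = y"
      by blast
    hence "y = theta_weight n k ms 0" unfolding u theta_weight_def by simp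
    thus ?thesis using ms by blast
  qed
  have g1: "g (0, 0, - of_nat j) = fps_nth P j" for j
  proof -
    have "{i. (\<Sum>_<i. - w\<delta>) = (0, 0, - of_nat j) \<and> fps_nth P i \<noteq> 0} = (if fps_nth P j \<noteq> 0 then {j} else {})"
      unfolding sum_const_weight by auto
    thus ?thesis by (simp only: g_def fps_at_def) simp
  qed
  have g0: "\<exists>j. z = (0, 0, - of_nat j)" if gz: "g z \<noteq> 0" for z
  proof -
    obtain j where "j \<in> {i. (\<Sum>_<i. - w\<delta>) = z \<and> fps_nth P i \<noteq> 0}"
      using gz unfolding g_def fps_at_def by (rule sum.not_neutral_contains_not_neutral)
    thus ?thesis unfolding sum_const_weight by auto
  qed
  have diff: "theta_weight n k ms j - theta_weight n k ms 0 = (0, 0, - of_nat j)" for ms j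
    by (simp add: theta_weight_def)
  show "lattice_quotient n k (theta_weight n k ms j) = fps_nth (inverse (euler_phi 1 ^ (n - 1))) j"
    if "length ms = n" "sum_list ms = int k"
  proof -
    let ?x = "theta_weight n k ms j"
    have "(f \<star> g) ?x = (\<Sum>y\<in>{theta_weight n k ms 0}. f y * g (?x - y))"
      unfolding fmult_def
    proof (rule sum.mono_neutral_left)
      show "{y. f y \<noteq> 0 \<and> g (?x - y) \<noteq> 0} \<subseteq> {theta_weight n k ms 0}"
      proof safe
        fix y assume "f y \<noteq> 0" "g (?x - y) \<noteq> 0"
        then obtain ms' i where y: "y = theta_weight n k ms' 0" and "?x - y = (0, 0, - of_nat i)"
          using f0 g0 by meson
        hence "fst (?x - y) = 0" by simp
        hence "coset_coord n k ms = coset_coord n k ms'" unfolding y by (simp add: theta_weight_def)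
        thus "y = theta_weight n k ms 0" by (simp add: y theta_weight_def)
      qed
    qed auto
    thus ?thesis using f1[of ms] that by (simp add: L diff g1 P_def)
  qed
  show "\<exists>ms j. length ms = n \<and> sum_list ms = int k \<and> \<mu> = theta_weight n k ms j"
    if nz: "lattice_quotient n k \<mu> \<noteq> 0"
  proof -
    obtain y where "y \<in> {y. f y \<noteq> 0 \<and> g (\<mu> - y) \<noteq> 0}"
      using nz unfolding L fmult_def by (rule sum.not_neutral_contains_not_neutral)
    then obtain ms j where ms: "ms \<in> ?M" "y = theta_weight n k ms 0" and "\<mu> - y = (0, 0, - of_nat j)"
      using f0 g0 by blast
    hence "\<mu> = theta_weight n k ms 0 + (0, 0, - of_nat j)" by (metis diff_add_cancel add.commute)
    hence "\<mu> = theta_weight n k ms j" by (simp add: theta_weight_def)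
    thus ?thesis using ms by blast
  qed
qed

lemma part_N_dvd:
  assumes "\<forall>a\<in>set ns. 0 < a"
  shows "part_N ns > 0" and "a \<in> set ns \<Longrightarrow> a dvd part_N ns"
proof -
  have "Lcm (set ns) > 0" using assms by (auto simp: Lcm_0_iff intro!: Nat.gr0I)
  thus "part_N ns > 0" by (simp add: part_N_def Let_def)
  show "a dvd part_N ns" if "a \<in> set ns"
    using that by (auto simp: part_N_def Let_def intro: dvd_mult dvd_Lcm)
qed

text \<open>From the last height to the first, the cyclic difference is N((n_1+n_r)/(2 n_1 n_r) -
  1). The entry s_0 is without the -1, which leaves the extra N; hence the s_i add up to N and
  e^(-\<delta>) specializes to q^N.\<close>

lemma part_s_differences:
  assumes part: "is_partition ns n" and n: "n \<ge> 1"
  defines "h \<equiv> \<lambda>p. (of_nat (snd (principal_list (part_N ns) ns ! (p - 1))) -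
      of_nat (fst (principal_list (part_N ns) ns ! (p - 1)))) / 4"
  shows "part_s ns 0 = of_nat (part_N ns) + h n - h 1"
    and "0 < i \<Longrightarrow> i < n \<Longrightarrow> part_s ns i = h i - h (Suc i)"
proof -
  define N where "N = part_N ns"
  define H where "H = concat (map (principal_heights N) ns)"
  have pos: "\<forall>a\<in>set ns. 0 < a" and sum: "sum_list ns = n" using part by (auto simp: is_partition_def)
  have ne: "ns \<noteq> []" using sum n by auto
  have dvd: "a dvd N" if "a \<in> set ns" for a using part_N_dvd(2)[OF pos that] by (simp add: N_def)
  have "map (\<lambda>p. (of_nat (snd p) - of_nat (fst p)) / 4) (principal_list N ns) = H"
    unfolding principal_list_def H_def map_concat map_map comp_def
    by (intro arg_cong[where f = concat] map_cong refl map_principal_block) (use dvd pos in auto)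
  note H_eq = this
  have "length (principal_list N ns) = n"
    using principal_list_facts(1)[of N ns] part_N_dvd(1)[OF pos] dvd sum by (simp add: N_def)
  hence h: "h p = H ! (p - 1)" if "p \<in> {1..n}" for p
    using that unfolding h_def N_def[symmetric] H_eq[symmetric] by (subst nth_map) auto
  show "part_s ns i = h i - h (Suc i)" if i: "0 < i" "i < n"
  proof -
    have "part_s ns i = of_nat N * part_blocks ns ! (i - 1)"
      using i by (cases i) (simp_all add: part_s_def N_def)
    also have "\<dots> = H ! (i - 1) - H ! Suc (i - 1)"
      using part_blocks_differences[OF ne pos] i unfolding H_def sum by simp
    finally show ?thesis using i by (simp add: h)
  qed
  have len: "length (principal_heights N a) = a" for a by (simp add: principal_heights_def)
  have hd: "H ! 0 = of_nat N * (of_nat (hd ns) - 1) / (2 * of_nat (hd ns))"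
    using ne pos unfolding H_def by (cases ns) (simp_all add: nth_append len, simp add: principal_heights_def)
  have last: "H ! (n - 1) = of_nat N * (1 - of_nat (last ns)) / (2 * of_nat (last ns))"
  proof -
    have l: "last ns > 0" "last ns \<in> set ns" using ne pos by auto
    have lenH: "length H = n" by (simp add: H_def length_concat comp_def len sum)
    have nsl: "ns = butlast ns @ [last ns]" using ne by simp
    have H: "H = concat (map (principal_heights N) (butlast ns)) @ principal_heights N (last ns)"
      unfolding H_def by (subst nsl) (simp only: map_append concat_append list.map concat.simps append_Nil2)
    have "principal_heights N (last ns) \<noteq> []" using l by (simp add: principal_heights_def)
    hence "last H = last (principal_heights N (last ns))" "H \<noteq> []" unfolding H by simp_all
    hence "H ! (n - 1) = last (principal_heights N (last ns))" using last_conv_nth[of H] lenH by simp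
    also have "\<dots> = principal_heights N (last ns) ! (last ns - 1)"
      using \<open>principal_heights N (last ns) \<noteq> []\<close> by (simp add: last_conv_nth len)
    also have "\<dots> = of_nat N * (of_nat (last ns) - 1 - 2 * of_nat (last ns - 1)) / (2 * of_nat (last ns))"
      using l by (simp add: principal_heights_def)
    finally show ?thesis using l by (simp add: of_nat_diff Suc_le_eq algebra_simps)
  qed
  have "(of_nat (hd ns) :: rat) \<noteq> 0" "(of_nat (last ns) :: rat) \<noteq> 0" using ne pos by auto
  hence "of_nat N * (of_nat (hd ns + last ns) / of_nat (2 * hd ns * last ns)) =
      (of_nat N + of_nat N * (1 - of_nat (last ns)) / (2 * of_nat (last ns)) -
       of_nat N * (of_nat (hd ns) - 1) / (2 * of_nat (hd ns)) :: rat)"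
    by (simp add: field_simps)
  thus "part_s ns 0 = of_nat (part_N ns) + h n - h 1"
    using n hd last by (simp add: h part_s_def N_def)
qed

text \<open>All coordinates have the same quadratic coefficient N, so the mixed terms of m_i and k/n
  sum to a multiple of k and the shift by k/n costs only a constant. The rest matches since al + be
  = 2 N turns al tri(m) + be tri(m - 1) into N m^2 + (al - be) m / 2.\<close>

lemma spec_exponent_theta_weight:
  assumes part: "is_partition ns n" and n: "n \<ge> 2" and k: "k < n"
  shows "\<exists>c. \<forall>ms j. length ms = n \<longrightarrow> sum_list ms = int k \<longrightarrow>
     spec_exponent n (part_s ns) v (theta_weight n k ms j) =
       c + of_nat (theta_exp (principal_list (part_N ns) ns) ms + 2 * part_N ns * j) / 2"
proof -
  define N where "N = part_N ns"
  define ab where "ab = principal_list N ns"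
  define \<kappa> :: rat where "\<kappa> = of_nat k / of_nat n"
  define al where "al i = (of_nat (fst (ab ! i)) :: rat)" for i
  define be where "be i = (of_nat (snd (ab ! i)) :: rat)" for i
  \<comment> \<open>The terms free of m and j after expanding N (m_i - \<kappa>)^2 + (al i - be
    i)(m_i - \<kappa>)/2, with the sum of the m_i replaced by k.\<close>
  define c where "c = v + (of_nat n * of_nat N * \<kappa>\<^sup>2 - 2 * of_nat N * \<kappa> * of_nat k - \<kappa> / 2 * (\<Sum>i<n. al i - be i)) / 2"
  have pos: "\<forall>a\<in>set ns. 0 < a" and sum: "sum_list ns = n" using part by (auto simp: is_partition_def)
  have len: "length ab = n" and ab: "p \<in> set ab \<Longrightarrow> fst p + snd p = 2 * N" for p
    using principal_list_facts[OF part_N_dvd[OF pos]] sum by (auto simp: ab_def N_def)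
  have albe: "al i + be i = 2 * of_nat N" if "i < n" for i
  proof -
    have "of_nat (fst (ab ! i) + snd (ab ! i)) = (of_nat (2 * N) :: rat)" using ab[of "ab ! i"] that len by simp
    thus ?thesis by (simp add: al_def be_def)
  qed
  have "spec_exponent n (part_s ns) v (theta_weight n k ms j) = c + of_nat (theta_exp ab ms + 2 * N * j) / 2"
    if ms: "length ms = n" "sum_list ms = int k" for ms j
  proof -
    define x where "x = coset_coord n k ms"
    have xS: "x (Suc i) = of_int (ms ! i) - \<kappa>" if "i < n" for i using that by (simp add: x_def coset_coord_def \<kappa>_def)
    have summ: "(\<Sum>i<n. of_int (ms ! i)) = (of_nat k :: rat)"
    proof -
      have "(\<Sum>i<n. of_int (ms ! i)) = (of_int (sum_list ms) :: rat)"
        using ms(1) by (simp add: sum_list_eq_sum_nth)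
      thus ?thesis using ms(2) by simp
    qed
    have tri: "(of_nat (tri m) :: rat) = of_int m * (of_int m + 1) / 2" for m
    proof -
      have "of_int (2 * int (tri m)) = (of_int (m * (m + 1)) :: rat)" by (simp only: int_tri)
      thus ?thesis by simp
    qed
    have "spec_exponent n (part_s ns) v (theta_weight n k ms j) =
        1 * v - (- (\<Sum>p=1..n. (x p)\<^sup>2) / 2 - of_nat j) * of_nat N - (\<Sum>p=1..n. (be (p - 1) - al (p - 1)) / 4 * x p)"
      unfolding theta_weight_def x_def[symmetric]
    proof (rule spec_exponent_eq[OF n])
      show "\<And>p. p \<notin> {1..n} \<Longrightarrow> x p = 0" by (auto simp: x_def coset_coord_def)
      show "(\<Sum>p=1..n. x p) = 0" unfolding x_def by (rule coset_coord_sum) (use ms n in auto)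
      show "part_s ns 0 = of_nat N + (be (n - 1) - al (n - 1)) / 4 - (be (1 - 1) - al (1 - 1)) / 4"
        using part_s_differences(1)[OF part] n by (simp add: al_def be_def ab_def N_def)
      show "part_s ns i = (be (i - 1) - al (i - 1)) / 4 - (be (Suc i - 1) - al (Suc i - 1)) / 4" if "0 < i" "i < n" for i
        using part_s_differences(2)[OF part _ that] n by (simp add: al_def be_def ab_def N_def)
    qed
    also have "\<dots> = v + of_nat N * of_nat j + (\<Sum>i<n. of_nat N * (x (Suc i))\<^sup>2 + (al i - be i) / 2 * x (Suc i)) / 2"
    proof -
      define S1 where "S1 = (\<Sum>i<n. (x (Suc i))\<^sup>2)"
      define S2 where "S2 = (\<Sum>i<n. (al i - be i) / 2 * x (Suc i))"
      have "(\<Sum>i<n. of_nat N * (x (Suc i))\<^sup>2 + (al i - be i) / 2 * x (Suc i)) = of_nat N * S1 + S2"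
        by (simp only: sum.distrib sum_distrib_left S1_def S2_def)
      moreover have "(\<Sum>p=1..n. (x p)\<^sup>2) = S1" unfolding S1_def by (rule sum_shift_1)
      moreover have "(\<Sum>p=1..n. (be (p - 1) - al (p - 1)) / 4 * x p) = - S2 / 2"
        unfolding sum_shift_1 sum_divide_distrib sum_negf[symmetric] S2_def
        by (intro sum.cong refl) (simp add: field_simps)
      ultimately show ?thesis by (simp only:) (simp add: field_simps)
    qed
    also have "(\<Sum>i<n. of_nat N * (x (Suc i))\<^sup>2 + (al i - be i) / 2 * x (Suc i)) =
       (\<Sum>i<n. (al i * of_nat (tri (ms ! i)) + be i * of_nat (tri (ms ! i - 1))) +
          (of_nat N * \<kappa>\<^sup>2 - 2 * of_nat N * \<kappa> * of_int (ms ! i) - \<kappa> / 2 * (al i - be i)))"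
    proof (intro sum.cong refl)
      fix i assume "i \<in> {..<n}"
      hence i: "i < n" by simp
      have be: "be i = 2 * of_nat N - al i" using albe[OF i] by simp
      show "of_nat N * (x (Suc i))\<^sup>2 + (al i - be i) / 2 * x (Suc i) =
        al i * of_nat (tri (ms ! i)) + be i * of_nat (tri (ms ! i - 1)) +
          (of_nat N * \<kappa>\<^sup>2 - 2 * of_nat N * \<kappa> * of_int (ms ! i) - \<kappa> / 2 * (al i - be i))"
        unfolding xS[OF i] tri be by (simp add: field_simps power2_eq_square)
    qed
    also have "\<dots> = of_nat (theta_exp ab ms) +
        (of_nat n * of_nat N * \<kappa>\<^sup>2 - 2 * of_nat N * \<kappa> * of_nat k - \<kappa> / 2 * (\<Sum>i<n. al i - be i))"
    proof -
      have "(\<Sum>i<n. al i * of_nat (tri (ms ! i)) + be i * of_nat (tri (ms ! i - 1))) = of_nat (theta_exp ab ms)"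
        by (simp add: theta_exp_def len al_def be_def)
      moreover have "(\<Sum>i<n. of_nat N * \<kappa>\<^sup>2 - 2 * of_nat N * \<kappa> * of_int (ms ! i) - \<kappa> / 2 * (al i - be i)) =
        of_nat n * of_nat N * \<kappa>\<^sup>2 - 2 * of_nat N * \<kappa> * of_nat k - \<kappa> / 2 * (\<Sum>i<n. al i - be i)"
        unfolding sum_subtractf[of _ "\<lambda>i. \<kappa> / 2 * (al i - be i)"] sum_subtractf[of "\<lambda>i. of_nat N * \<kappa>\<^sup>2"]
          sum_distrib_left[symmetric] summ by (simp add: mult.assoc)
      ultimately show ?thesis unfolding sum.distrib[of _ _ "{..<n}"] by simp
    qed
    finally show ?thesis by (simp add: c_def field_simps)
  qed
  thus ?thesis unfolding N_def[symmetric] ab_def[symmetric] by blast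
qed

lemma theta_weight_inj:
  assumes "theta_weight n k ms j = theta_weight n k ms' j'" "length ms = n" "length ms' = n"
  shows "ms = ms' \<and> j = j'"
proof -
  have "coset_coord n k ms = coset_coord n k ms'" using assms(1) by (simp add: theta_weight_def)
  hence "ms = ms'" by (rule coset_coord_inj) (use assms in auto)
  thus ?thesis using assms(1) by (simp add: theta_weight_def)
qed

text \<open>Apart from a constant, the exponent is half of \<open>theta_exp\<close> plus 2 N j. Both
  summands are nonnegative, the first bounds ms and the second bounds j, so each power of q receives
  finitely many terms.\<close>

lemma specialize_lattice_quotient:
  assumes n: "n \<ge> 2" and part: "is_partition ns n" and k: "k < n"
  shows "specializable n (part_s ns) v (lattice_quotient n k)"
    and "\<exists>c. specialize n (part_s ns) v (lattice_quotient n k) =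
      half_series c (theta_fps (principal_list (part_N ns) ns) (int k) *
        inverse (euler_phi (2 * part_N ns)) ^ (n - 1))"
proof -
  define N where "N = part_N ns"
  define ab where "ab = principal_list N ns"
  define P where "P = inverse (euler_phi 1 ^ (n - 1) :: complex fps)"
  define L where "L = lattice_quotient n k"
  define M where "M = {ms :: int list. length ms = n \<and> sum_list ms = int k}"
  define W where "W = (\<lambda>(ms, j). theta_weight n k ms j)"
  have pos: "\<forall>a\<in>set ns. 0 < a" and sum: "sum_list ns = n" using part by (auto simp: is_partition_def)
  have N0: "N > 0" using part_N_dvd[OF pos] by (simp add: N_def)
  have len: "length ab = n" and ab: "\<forall>p\<in>set ab. 0 < fst p \<and> 0 < snd p"
    using principal_list_facts[OF part_N_dvd[OF pos]] sum by (auto simp: ab_def N_def)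
  obtain c where c: "\<And>ms j. ms \<in> M \<Longrightarrow> spec_exponent n (part_s ns) v (theta_weight n k ms j) =
       c + of_nat (theta_exp ab ms + 2 * N * j) / 2"
    using spec_exponent_theta_weight[OF part n k, of v] unfolding M_def ab_def N_def by blast
  have L1: "L (theta_weight n k ms j) = fps_nth P j" if "ms \<in> M" for ms j
    using lattice_quotient_eq(1)[OF n k] that by (simp add: L_def P_def M_def)
  have L0: "\<exists>ms\<in>M. \<exists>j. \<mu> = theta_weight n k ms j" if "L \<mu> \<noteq> 0" for \<mu>
    using lattice_quotient_eq(2)[OF n k, of \<mu>] that unfolding L_def M_def by blast
  define T where "T t = {ms. length ms = length ab \<and> sum_list ms = int k \<and> theta_exp ab ms \<le> t}" for t
  \<comment> \<open>The pairs (ms, j) that are sent to X^t. Some of them may have coefficient 0, so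
    \<open>W\<close> followed by Z only contains the support.\<close>
  define Z where "Z t = (SIGMA ms:T t. {j. theta_exp ab ms + 2 * N * j = t})" for t
  have finT: "finite (T t)" for t
    unfolding T_def by (rule finite_subset[OF _ finite_theta_exp_le[OF ab, of t]]) auto
  have j_le: "j \<le> t" if "s + 2 * N * j = t" for s j t
  proof -
    have "1 * j \<le> 2 * N * j" using N0 by (intro mult_le_mono1) simp
    thus ?thesis using that by linarith
  qed
  have finj: "finite {j. s + 2 * N * j = t}" for s t
  proof (rule finite_subset)
    show "{j. s + 2 * N * j = t} \<subseteq> {..t}" using j_le by blast
  qed simp
  have finZ: "finite (Z t)" for t unfolding Z_def using finT finj by blast
  have supp: "{\<mu>. L \<mu> \<noteq> 0 \<and> spec_exponent n (part_s ns) v \<mu> = c + of_nat t / 2} \<subseteq> W ` Z t" for t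
  proof
    fix \<mu> assume "\<mu> \<in> {\<mu>. L \<mu> \<noteq> 0 \<and> spec_exponent n (part_s ns) v \<mu> = c + of_nat t / 2}"
    then obtain ms j where ms: "ms \<in> M" "\<mu> = theta_weight n k ms j"
      "spec_exponent n (part_s ns) v \<mu> = c + of_nat t / 2" using L0 by blast
    hence "of_nat (theta_exp ab ms + 2 * N * j) = (of_nat t :: rat)" using c[OF ms(1), of j] by simp
    hence t: "theta_exp ab ms + 2 * N * j = t" by (simp only: of_nat_eq_iff)
    hence "(ms, j) \<in> Z t" using ms(1) by (auto simp: Z_def T_def M_def len)
    thus "\<mu> \<in> W ` Z t" using ms(2) by (auto simp: W_def intro!: image_eqI[of _ _ "(ms, j)"])
  qed
  have range: "\<exists>t::nat. x = c + of_nat t / 2" if "L \<mu> \<noteq> 0" "spec_exponent n (part_s ns) v \<mu> = x" for \<mu> x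
    using L0[OF that(1)] that(2) c by metis
  show "specializable n (part_s ns) v (lattice_quotient n k)"
    unfolding specializable_def L_def[symmetric]
  proof
    fix x
    show "finite {\<mu>. L \<mu> \<noteq> 0 \<and> spec_exponent n (part_s ns) v \<mu> = x}"
    proof (cases "\<exists>t::nat. x = c + of_nat t / 2")
      case True
      then obtain t :: nat where x: "x = c + of_nat t / 2" by blast
      show ?thesis unfolding x by (rule finite_subset[OF supp]) (simp add: finZ)
    next
      case False
      hence "{\<mu>. L \<mu> \<noteq> 0 \<and> spec_exponent n (part_s ns) v \<mu> = x} = {}" using range by blast
      thus ?thesis by (simp only: finite.emptyI)
    qed
  qed
  have P0: "fps_nth (euler_phi 1 ^ (n - 1) :: complex fps) 0 \<noteq> 0"
    by (simp add: fps_nth_power_0 euler_phi_nth_0)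
  have X0: "fps_nth (fps_X ^ (2 * N) :: complex fps) 0 = 0" using N0 by simp
  \<comment> \<open>Since e^(-\<delta>) goes to q^N = X^(2 N), the Euler products of the imaginary
    roots become Euler products in X^(2 N).\<close>
  have comp: "P oo fps_X ^ (2 * N) = inverse (euler_phi (2 * N)) ^ (n - 1)"
    unfolding P_def fps_inverse_compose[OF X0 P0] fps_compose_power[OF X0, symmetric]
    using euler_phi_compose[of 1 "2 * N", where 'a = complex] N0 by (simp add: fps_inverse_power)
  have "specialize n (part_s ns) v L = half_series c (theta_fps ab (int k) * (P oo fps_X ^ (2 * N)))"
  proof (rule half_series_eqI)
    fix t :: nat
    have "specialize n (part_s ns) v L (c + of_nat t / 2) = (\<Sum>\<mu>\<in>W ` Z t. L \<mu>)"
      unfolding specialize_def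
    proof (rule sum.mono_neutral_left)
      show "\<forall>\<mu>\<in>W ` Z t - {\<mu>. L \<mu> \<noteq> 0 \<and> spec_exponent n (part_s ns) v \<mu> = c + of_nat t / 2}. L \<mu> = 0"
      proof
        fix \<mu> assume \<mu>: "\<mu> \<in> W ` Z t - {\<mu>. L \<mu> \<noteq> 0 \<and> spec_exponent n (part_s ns) v \<mu> = c + of_nat t / 2}"
        then obtain ms j where mj: "(ms, j) \<in> Z t" "\<mu> = theta_weight n k ms j" by (auto simp: W_def)
        hence ms: "ms \<in> M" and t: "theta_exp ab ms + 2 * N * j = t" by (auto simp: Z_def T_def M_def len)
        have "spec_exponent n (part_s ns) v \<mu> = c + of_nat t / 2" by (simp only: mj(2) c[OF ms] t)
        thus "L \<mu> = 0" using \<mu> by blast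
      qed
    qed (use finZ supp in auto)
    also have "\<dots> = (\<Sum>z\<in>Z t. L (W z))"
    proof (rule sum.reindex[unfolded comp_def])
      show "inj_on W (Z t)"
        by (rule inj_onI) (auto simp: W_def Z_def T_def len dest!: theta_weight_inj)
    qed
    also have "\<dots> = (\<Sum>(ms, j)\<in>Z t. fps_nth P j)"
      by (intro sum.cong refl) (auto simp: W_def Z_def T_def len M_def intro!: L1)
    also have "\<dots> = (\<Sum>ms\<in>T t. \<Sum>j | theta_exp ab ms + 2 * N * j = t. fps_nth P j)"
      unfolding Z_def by (rule sum.Sigma[symmetric]) (use finT finj in auto)
    also have "\<dots> = (\<Sum>ms\<in>T t. fps_nth (P oo fps_X ^ (2 * N)) (t - theta_exp ab ms))"
    proof (intro sum.cong refl)
      fix ms assume "ms \<in> T t"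
      then obtain s where s: "t = theta_exp ab ms + s" by (auto simp: T_def le_iff_add)
      have "{j. theta_exp ab ms + 2 * N * j = t} = (if 2 * N dvd s then {s div (2 * N)} else {})"
        unfolding s using N0 by (auto simp: dvd_def)
      thus "(\<Sum>j | theta_exp ab ms + 2 * N * j = t. fps_nth P j) = fps_nth (P oo fps_X ^ (2 * N)) (t - theta_exp ab ms)"
        by (simp only: fps_nth_compose_X_power) (simp add: s)
    qed
    also have "\<dots> = fps_nth (theta_fps ab (int k) * (P oo fps_X ^ (2 * N))) t"
      by (simp only: theta_fps_mult_nth[OF ab] T_def)
    finally show "specialize n (part_s ns) v L (c + of_nat t / 2) =
      fps_nth (theta_fps ab (int k) * (P oo fps_X ^ (2 * N))) t" .
  next
    fix x assume "specialize n (part_s ns) v L x \<noteq> 0"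
    then obtain \<mu> where "\<mu> \<in> {\<mu>. L \<mu> \<noteq> 0 \<and> spec_exponent n (part_s ns) v \<mu> = x}"
      unfolding specialize_def by (rule sum.not_neutral_contains_not_neutral)
    thus "\<exists>t::nat. x = c + of_nat t / 2" using range by blast
  qed
  thus "\<exists>c. specialize n (part_s ns) v (lattice_quotient n k) =
      half_series c (theta_fps (principal_list (part_N ns) ns) (int k) *
        inverse (euler_phi (2 * part_N ns)) ^ (n - 1))"
    unfolding comp unfolding L_def ab_def N_def by blast
qed

theorem proposition5p1:
  fixes n k :: nat and ns :: "nat list" and v :: rat
  assumes "n \<ge> 2" and "is_partition ns n" and "k < n"
  shows "specializable n (part_s ns) v (lattice_quotient n k) \<and>
    (\<exists>const::rat.
      specialize n (part_s ns) v (lattice_quotient n k) =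
        fexp const
        \<star> fps_at 1 (\<Prod>j. 1 - fps_X ^ (Suc j * part_N ns))
        \<star> theta_sum ns k
        \<star> fps_at 1 (inverse (block_product ns)))"
proof -
  define N where "N = part_N ns"
  have pos: "\<forall>a\<in>set ns. 0 < a" and sum: "sum_list ns = n" using assms(2) by (auto simp: is_partition_def)
  have N0: "N > 0" and dvd: "\<And>a. a \<in> set ns \<Longrightarrow> a dvd N" using part_N_dvd[OF pos] by (auto simp: N_def)
  have d: "N div a > 0" if "a \<in> set ns" for a using dvd[OF that] N0 by (auto elim!: dvdE)
  define T where "T = (theta_fps (principal_list N ns) (int k) :: complex fps)"
  define T' where "T' = (theta_fps (map (\<lambda>a. (N div a, N div a)) ns) (int k) :: complex fps)"
  define B where "B = (\<Prod>i<length ns. inverse (euler_phi (2 * (N div ns ! i)) :: complex fps))"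
  obtain c where c: "specialize n (part_s ns) v (lattice_quotient n k) =
      half_series c (T * inverse (euler_phi (2 * N)) ^ (n - 1))"
    using specialize_lattice_quotient(2)[OF assms] unfolding T_def N_def by blast
  have X0: "fps_nth (fps_X ^ 2 :: complex fps) 0 = 0" by simp
  have num: "fps_at 1 (\<Prod>j. 1 - fps_X ^ (Suc j * part_N ns)) = half_series 0 (euler_phi (2 * N))"
    unfolding fps_at_eq_half_series euler_phi_def[symmetric] N_def[symmetric]
    by (subst euler_phi_compose) (use N0 in \<open>simp_all add: mult.commute\<close>)
  have den: "fps_at 1 (inverse (block_product ns)) = half_series 0 B"
  proof -
    have bp: "block_product ns = (\<Prod>i<length ns. euler_phi (N div ns ! i))"
      by (simp add: block_product_def euler_phi_def N_def)
    have "fps_nth (block_product ns) 0 \<noteq> 0"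
      using d by (simp add: bp fps_prod_nth_0 euler_phi_nth_0)
    hence "inverse (block_product ns) oo fps_X ^ 2 = inverse (block_product ns oo fps_X ^ 2)"
      by (rule fps_inverse_compose[OF X0])
    also have "\<dots> = B"
      unfolding bp fps_compose_prod_distrib[OF X0] fps_inverse_prod B_def
      by (intro prod.cong refl arg_cong[where f = inverse], subst euler_phi_compose) (use d in \<open>simp_all add: mult.commute\<close>)
    finally show ?thesis by (simp only: fps_at_eq_half_series)
  qed
  have theta: "theta_sum ns k = half_series 0 T'"
    unfolding T'_def N_def by (rule theta_sum_eq_half_series) (use dvd pos in \<open>auto simp: N_def\<close>)
  have phi: "euler_phi (2 * N) * inverse (euler_phi (2 * N)) = (1 :: complex fps)"
    by (rule inverse_mult_eq_1') (use N0 in \<open>simp add: euler_phi_nth_0\<close>)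
  have nS: "n = Suc (n - 1)" using assms(1) by simp
  \<comment> \<open>The comparison of the two factorizations needs n inverse Euler products, one per
    pair. Supplying the missing one produces the numerator.\<close>
  have "T * inverse (euler_phi (2 * N)) ^ (n - 1) =
      euler_phi (2 * N) * (T * inverse (euler_phi (2 * N)) ^ n)"
    by (subst (2) nS) (simp add: phi mult.left_commute mult.assoc[symmetric] power_Suc)
  also have "T * inverse (euler_phi (2 * N)) ^ n = T' * B"
    using theta_principal_blocks[OF N0 dvd, of ns k, where 'a = complex]
    by (simp add: sum T_def T'_def B_def)
  finally have "specialize n (part_s ns) v (lattice_quotient n k) =
      fexp c \<star> half_series 0 (euler_phi (2 * N)) \<star> half_series 0 T' \<star> half_series 0 B"
    unfolding c by (simp add: fexp_eq_half_series half_series_mult mult.assoc)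
  thus ?thesis unfolding num theta den using specialize_lattice_quotient(1)[OF assms] by blast
qed

end
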